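(* Let $\theta\in(0,1)$, $\alpha>0$ and let $(\Sigma,\sigma)$ be the one-sided countable full shift equipped with the metric $$d_2(\underline{x},\underline{y})=\sum_{n\ge 0}\theta^n\left|\frac1{e^{\alpha x_n}}-\frac1{e^{\alpha y_n}}\right|.$$ Let $\phi:\Sigma\to\mathbb{R}$ be a potential such that $\phi|_{[n]}\le-\kappa\log(n+1)$ (for $n\in\mathbb{N}$) for some $\kappa>1$, which admits the Gibbs measure $\mu$. Then there exist $0<c<C<\infty$ and $\varepsilon>0$ such that for all $\delta>0$, we have $$\frac{c}{M_\mu(\delta/\varepsilon)}\le\mathbb{E}(\tau_\delta)\le\frac{C}{M_\mu(\varepsilon\delta)}\left(\log\frac1\delta\right)\left(\log\left(\log\frac1\delta\right)\right).$$
   Context: Here $\mathbb{N}=\{1,2,\dots\}$, $\mathbb{N}_0=\mathbb{N}\cup\{0\}$. The one-sided countable full shift is $\Sigma=\mathbb{N}^{\mathbb{N}_0}$, with elements $\underline{x}=(x_0,x_1,\dots)$, and shift map $\sigma(x_0,x_1,x_2,\dots)=(x_1,x_2,\dots)$. For $y_0,\dots,y_{n-1}\in\mathbb{N}$ the $n$-cylinder is $[y_0,\dots,y_{n-1}]=\{\underline{x}\in\Sigma:x_0=y_0,\dots,x_{n-1}=y_{n-1}\}$; in particular $[n]=\{\underline{x}\in\Sigma:x_0=n\}$. Gibbs measure: a $\sigma$-invariant probability measure $\mu$ on $\Sigma$ is a Gibbs measure for $\phi$ if there are constants $K>1$ and $P$ such that for every $n$, every $n$-cylinder $Z_n$ and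 every $\underline{x}\in Z_n$, $$K^{-1}\le\frac{\mu(Z_n)}{e^{S_n\phi(\underline{x})-nP}}\le K,\qquad S_n\phi(\underline{x})=\sum_{i=0}^{n-1}\phi(\sigma^i(\underline{x})).$$ A set $A$ is $\delta$-dense in $\Sigma$ if for every $b\in\Sigma$ there is $a\in A$ with $d_2(a,b)\le\delta$. The $\delta$-covering time is $\tau_\delta:\Sigma\to\mathbb{N}\cup\{\infty\}$, $$\tau_\delta(\underline{x})=\inf\{n\ge1:\{\underline{x},\sigma(\underline{x}),\dots,\sigma^n(\underline{x})\}\text{ is }\delta\text{-dense in }\Sigma\},$$ and $\mathbb{E}(\tau_\delta)=\int\tau_\delta\,d\mu$ is its expectation with respect to $\mu$. $M_\mu(r)=\min_{\underline{x}\in\operatorname{supp}(\mu)}\mu(B(\underline{x},r))$, where $B(\underline{x},r)$ is the ball of radius $r$ about $\underline{x}$ in the metric $d_2$.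
   Formalization: The upper bound is claimed for 0<δ≤δ₀, for each δ₀<1/e, with constants that may depend on δ₀: at δ=1/e its right side is 0 while τ_δ≥1, and for larger δ it is negative or undefined. The lower bound is for all δ>0. The minimum in M_μ is read as an infimum. *)

theory Defs
  imports "HOL-Probability.Probability"
begin

text \<open>The full shift over the alphabet \<open>{1, 2, \<dots>}\<close> is a set of functions \<open>nat \<Rightarrow> nat\<close>, so the
  letter 0 is excluded by the carrier.\<close>

definition full_shift :: "(nat \<Rightarrow> nat) set" where
  "full_shift = {x. \<forall>i. 1 \<le> x i}"

definition shift :: "(nat \<Rightarrow> nat) \<Rightarrow> nat \<Rightarrow> nat" where
  "shift x = (\<lambda>i. x (Suc i))"

definition cylinder :: "nat list \<Rightarrow> (nat \<Rightarrow> nat) set" where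
  "cylinder ys = {x \<in> full_shift. \<forall>i<length ys. x i = ys ! i}"

definition d2 :: "real \<Rightarrow> real \<Rightarrow> (nat \<Rightarrow> nat) \<Rightarrow> (nat \<Rightarrow> nat) \<Rightarrow> real" where
  "d2 \<theta> \<alpha> x y = (\<Sum>n. \<theta> ^ n * \<bar>1 / exp (\<alpha> * real (x n)) - 1 / exp (\<alpha> * real (y n))\<bar>)"

text \<open>Only its \<open>\<sigma>\<close>-algebra, the one generated by the cylinders, is used. Lemma
  \<open>sets_shift_space_eq_borel\<close> below shows that it is the Borel \<open>\<sigma>\<close>-algebra of every \<open>d2 \<theta> \<alpha>\<close>.\<close>

definition shift_space :: "(nat \<Rightarrow> nat) measure" where
  "shift_space = PiM UNIV (\<lambda>_. count_space {1..})"

definition birkhoff_sum :: "((nat \<Rightarrow> nat) \<Rightarrow> real) \<Rightarrow> nat \<Rightarrow> (nat \<Rightarrow> nat) \<Rightarrow> real" where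
  "birkhoff_sum \<phi> n x = (\<Sum>i<n. \<phi> ((shift ^^ i) x))"

definition gibbs_measure :: "((nat \<Rightarrow> nat) \<Rightarrow> real) \<Rightarrow> (nat \<Rightarrow> nat) measure \<Rightarrow> bool" where
  "gibbs_measure \<phi> \<mu> \<longleftrightarrow>
     prob_space \<mu> \<and> sets \<mu> = sets shift_space \<and> distr \<mu> \<mu> shift = \<mu> \<and>
     (\<exists>K P. 1 < K \<and>
       (\<forall>ys. ys \<noteq> [] \<and> set ys \<subseteq> {1..} \<longrightarrow>
         (\<forall>x\<in>cylinder ys.
            1 / K \<le> measure \<mu> (cylinder ys)
                     / exp (birkhoff_sum \<phi> (length ys) x - real (length ys) * P) \<and>
            measure \<mu> (cylinder ys)
              / exp (birkhoff_sum \<phi> (length ys) x - real (length ys) * P) \<le> K)))"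

definition delta_dense :: "real \<Rightarrow> real \<Rightarrow> real \<Rightarrow> (nat \<Rightarrow> nat) set \<Rightarrow> bool" where
  "delta_dense \<theta> \<alpha> \<delta> A \<longleftrightarrow> (\<forall>b\<in>full_shift. \<exists>a\<in>A. d2 \<theta> \<alpha> a b \<le> \<delta>)"

definition covering_time :: "real \<Rightarrow> real \<Rightarrow> real \<Rightarrow> (nat \<Rightarrow> nat) \<Rightarrow> enat" where
  "covering_time \<theta> \<alpha> \<delta> x =
     (INF n \<in> {n. 1 \<le> n \<and> delta_dense \<theta> \<alpha> \<delta> ((\<lambda>i. (shift ^^ i) x) ` {0..n})}. enat n)"

definition expected_covering_time ::
  "real \<Rightarrow> real \<Rightarrow> (nat \<Rightarrow> nat) measure \<Rightarrow> real \<Rightarrow> ennreal" where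
  "expected_covering_time \<theta> \<alpha> \<mu> \<delta> = (\<integral>\<^sup>+ x. ennreal_of_enat (covering_time \<theta> \<alpha> \<delta> x) \<partial>\<mu>)"

definition topological_support :: "'a topology \<Rightarrow> 'a measure \<Rightarrow> 'a set" where
  "topological_support X \<mu> =
     {x \<in> topspace X. \<forall>U. openin X U \<and> x \<in> U \<longrightarrow> 0 < emeasure \<mu> U}"

text \<open>The minimum over the support is taken as an infimum: the full shift is not compact for
  \<open>d2 \<theta> \<alpha>\<close>, and an infimum agrees with the minimum whenever the latter is attained.\<close>

definition min_ball_measure ::
  "real \<Rightarrow> real \<Rightarrow> (nat \<Rightarrow> nat) measure \<Rightarrow> real \<Rightarrow> real" where
  "min_ball_measure \<theta> \<alpha> \<mu> r =
     (INF x \<in> topological_support (Metric_space.mtopology full_shift (d2 \<theta> \<alpha>)) \<mu>.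
        measure \<mu> (Metric_space.mball full_shift (d2 \<theta> \<alpha>) x r))"

context
  fixes \<theta> \<alpha> :: real
  assumes \<theta>: "0 < \<theta>" "\<theta> < 1" and \<alpha>: "0 < \<alpha>"
begin

private lemma diff_le_1: "\<bar>1 / exp (\<alpha> * real m) - 1 / exp (\<alpha> * real n)\<bar> \<le> 1"
proof -
  have "0 \<le> 1 / exp (\<alpha> * real k) \<and> 1 / exp (\<alpha> * real k) \<le> 1" for k
    using \<alpha> by (simp add: divide_le_eq)
  from this[of m] this[of n] show ?thesis unfolding abs_le_iff by linarith
qed

lemma summable_d2:
  "summable (\<lambda>n. \<theta> ^ n * \<bar>1 / exp (\<alpha> * real (x n)) - 1 / exp (\<alpha> * real (y n))\<bar>)"
proof (rule summable_comparison_test')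
  show "summable (\<lambda>n. \<theta> ^ n)" using \<theta> by (simp add: summable_geometric)
  show "norm (\<theta> ^ n * \<bar>1 / exp (\<alpha> * real (x n)) - 1 / exp (\<alpha> * real (y n))\<bar>) \<le> \<theta> ^ n"
    if "n \<ge> 0" for n
    using mult_left_mono[OF diff_le_1[of "x n" "y n"], of "\<theta> ^ n"] \<theta> by (simp add: abs_mult)
qed

private lemma d2_ge_term:
  "\<theta> ^ n * \<bar>1 / exp (\<alpha> * real (x n)) - 1 / exp (\<alpha> * real (y n))\<bar> \<le> d2 \<theta> \<alpha> x y"
  unfolding d2_def
  using sum_le_suminf[OF summable_d2, of "{n}" x y] \<theta> by simp

lemma Metric_space_d2: "Metric_space full_shift (d2 \<theta> \<alpha>)"
proof
  fix x y z
  show "0 \<le> d2 \<theta> \<alpha> x y"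
    unfolding d2_def by (rule suminf_nonneg[OF summable_d2]) (use \<theta> in simp)
  show "d2 \<theta> \<alpha> x y = d2 \<theta> \<alpha> y x"
    unfolding d2_def by (simp add: abs_minus_commute)
  show "(d2 \<theta> \<alpha> x y = 0) = (x = y)"
  proof
    assume 0: "d2 \<theta> \<alpha> x y = 0"
    show "x = y"
    proof
      fix n
      have "\<theta> ^ n * \<bar>1 / exp (\<alpha> * real (x n)) - 1 / exp (\<alpha> * real (y n))\<bar> \<le> 0"
        using d2_ge_term[of n x y] 0 by simp
      moreover have "\<not> \<theta> ^ n \<le> 0" using zero_less_power[OF \<theta>(1), of n] by linarith
      ultimately show "x n = y n" using \<alpha> by (auto simp: mult_le_0_iff)
    qed
  qed (simp add: d2_def)
  have "d2 \<theta> \<alpha> x z \<le> (\<Sum>n. \<theta> ^ n * \<bar>1 / exp (\<alpha> * real (x n)) - 1 / exp (\<alpha> * real (y n))\<bar>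
      + \<theta> ^ n * \<bar>1 / exp (\<alpha> * real (y n)) - 1 / exp (\<alpha> * real (z n))\<bar>)"
    unfolding d2_def
  proof (rule suminf_le[OF _ summable_d2 summable_add[OF summable_d2 summable_d2]])
    fix n
    show "\<theta> ^ n * \<bar>1 / exp (\<alpha> * real (x n)) - 1 / exp (\<alpha> * real (z n))\<bar>
      \<le> \<theta> ^ n * \<bar>1 / exp (\<alpha> * real (x n)) - 1 / exp (\<alpha> * real (y n))\<bar>
      + \<theta> ^ n * \<bar>1 / exp (\<alpha> * real (y n)) - 1 / exp (\<alpha> * real (z n))\<bar>"
      unfolding distrib_left[symmetric] by (rule mult_left_mono) (use \<theta> in auto)
  qed
  then show "d2 \<theta> \<alpha> x z \<le> d2 \<theta> \<alpha> x y + d2 \<theta> \<alpha> y z"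
    unfolding d2_def by (simp add: suminf_add[OF summable_d2 summable_d2])
qed

private lemma d2_le_of_prefix:
  assumes "\<And>i. i < N \<Longrightarrow> x i = y i"
  shows "d2 \<theta> \<alpha> x y \<le> \<theta> ^ N / (1 - \<theta>)"
proof -
  let ?f = "\<lambda>n. \<theta> ^ n * \<bar>1 / exp (\<alpha> * real (x n)) - 1 / exp (\<alpha> * real (y n))\<bar>"
  have "d2 \<theta> \<alpha> x y = (\<Sum>n. ?f (n + N)) + (\<Sum>i<N. ?f i)"
    unfolding d2_def by (rule suminf_split_initial_segment[OF summable_d2])
  also have "(\<Sum>i<N. ?f i) = 0" using assms by (intro sum.neutral) simp
  also have "(\<Sum>n. ?f (n + N)) \<le> (\<Sum>n. \<theta> ^ N * \<theta> ^ n)"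
  proof (rule suminf_le)
    show "?f (n + N) \<le> \<theta> ^ N * \<theta> ^ n" for n
      using mult_left_mono[OF diff_le_1[of "x (n+N)" "y (n+N)"], of "\<theta> ^ (n+N)"] \<theta>
      by (simp add: power_add[symmetric] add.commute)
    show "summable (\<lambda>n. ?f (n + N))" by (rule summable_ignore_initial_segment[OF summable_d2])
    show "summable (\<lambda>n. \<theta> ^ N * \<theta> ^ n)"
      using \<theta> by (intro summable_mult) (simp add: summable_geometric)
  qed
  also have "\<dots> = \<theta> ^ N / (1 - \<theta>)"
    using suminf_mult[OF summable_geometric[of \<theta>], of "\<theta> ^ N"] suminf_geometric[of \<theta>] \<theta> by simp
  finally show ?thesis by simp
qed

private lemma space_shift_space: "space shift_space = full_shift"
  by (auto simp: shift_space_def space_PiM full_shift_def PiE_def)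

private lemma coordinate_set: "{x \<in> full_shift. x i \<in> A} \<in> sets shift_space"
proof -
  have *: "(\<lambda>x. x i) \<in> measurable shift_space (count_space {1..})"
    unfolding shift_space_def by (rule measurable_component_singleton[OF UNIV_I])
  have "(\<lambda>x. x i) -` (A \<inter> {1..}) \<inter> space shift_space \<in> sets shift_space"
    by (rule measurable_sets[OF *]) auto
  also have "(\<lambda>x. x i) -` (A \<inter> {1..}) \<inter> space shift_space = {x \<in> full_shift. x i \<in> A}"
    by (auto simp: space_shift_space full_shift_def)
  finally show ?thesis .
qed

private lemma cylinder_in_sets: "cylinder ys \<in> sets shift_space"
proof -
  have coord: "{x \<in> space shift_space. x i = a} \<in> sets shift_space" for i a
    using coordinate_set[of i "{a}"] unfolding space_shift_space singleton_iff .
  have "{x \<in> space shift_space. \<forall>i\<in>{..<length ys}. x i = ys ! i} \<in> sets shift_space"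
    by (intro sets.sets_Collect_finite_All coord finite_lessThan)
  then show ?thesis unfolding cylinder_def space_shift_space Ball_def lessThan_iff .
qed

lemma sets_shift_space_eq_borel:
  "sets shift_space =
     sigma_sets full_shift {U. openin (Metric_space.mtopology full_shift (d2 \<theta> \<alpha>)) U}"
proof -
  interpret Metric_space full_shift "d2 \<theta> \<alpha>" by (rule Metric_space_d2)
  let ?B = "sigma_sets full_shift {U. openin mtopology U}"
  have open_coord: "openin mtopology {x \<in> full_shift. x i \<in> A}" for i A
    unfolding openin_mtopology
  proof (intro conjI ballI allI impI)
    fix x assume x: "x \<in> {x \<in> full_shift. x i \<in> A}"
    define k where "k = x i"
    define e where "e = \<theta> ^ i * exp (- \<alpha> * real k) * (1 - exp (- \<alpha>))"
    have "e > 0" using \<theta> \<alpha> by (simp add: e_def)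
    have gap: "exp (- \<alpha> * real k) * (1 - exp (- \<alpha>))
      \<le> \<bar>1 / exp (\<alpha> * real k) - 1 / exp (\<alpha> * real m)\<bar>" if "m \<noteq> k" for m
    proof -
      have eq: "1 / exp (\<alpha> * real n) = exp (- \<alpha> * real n)" for n
        by (simp add: exp_minus divide_inverse)
      consider "m \<ge> Suc k" | "Suc m \<le> k" using \<open>m \<noteq> k\<close> by (auto simp: nat_neq_iff Suc_le_eq)
      then show ?thesis
      proof cases
        case 1
        then have "real k + 1 \<le> real m" by linarith
        then have "\<alpha> * (real k + 1) \<le> \<alpha> * real m" using \<alpha> by (intro mult_left_mono) auto
        then have "exp (- \<alpha> * real m) \<le> exp (- \<alpha> * real k + - \<alpha>)"
          by (simp add: algebra_simps)
        then have "exp (- \<alpha> * real m) \<le> exp (- \<alpha> * real k) * exp (- \<alpha>)"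
          unfolding exp_add .
        then show ?thesis unfolding eq by (simp add: algebra_simps)
      next
        case 2
        then have "real m + 1 \<le> real k" by linarith
        then have "\<alpha> * (real m + 1) \<le> \<alpha> * real k" using \<alpha> by (intro mult_left_mono) auto
        then have "exp (- \<alpha> * real k) \<le> exp (- \<alpha> * real m + - \<alpha>)"
          by (simp add: algebra_simps)
        then have a: "exp (- \<alpha> * real k) \<le> exp (- \<alpha> * real m) * exp (- \<alpha>)"
          unfolding exp_add .
        have "exp (- \<alpha>) \<le> 1" using \<alpha> by simp
        then have "exp (- \<alpha> * real m) * exp (- \<alpha>) \<le> exp (- \<alpha> * real m)"
          by (simp add: mult_left_le)
        with a have b: "exp (- \<alpha> * real k) \<le> exp (- \<alpha> * real m)" by linarith
        have "exp (- \<alpha> * real k) * (1 - exp (- \<alpha>))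
            \<le> exp (- \<alpha> * real m) * (1 - exp (- \<alpha>))"
          using b \<alpha> by (intro mult_right_mono) auto
        also have "\<dots> \<le> exp (- \<alpha> * real m) - exp (- \<alpha> * real k)"
          using a by (simp add: algebra_simps)
        also have "\<dots> \<le> \<bar>exp (- \<alpha> * real k) - exp (- \<alpha> * real m)\<bar>" by linarith
        finally show ?thesis unfolding eq .
      qed
    qed
    have "mball x e \<subseteq> {x \<in> full_shift. x i \<in> A}"
    proof
      fix y assume y: "y \<in> mball x e"
      have "y i = k"
      proof (rule ccontr)
        assume "y i \<noteq> k"
        then have "e \<le> \<theta> ^ i * \<bar>1 / exp (\<alpha> * real (x i)) - 1 / exp (\<alpha> * real (y i))\<bar>"
          unfolding e_def mult.assoc using gap[of "y i"] \<theta> k_def by (intro mult_left_mono) auto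
        also have "\<dots> \<le> d2 \<theta> \<alpha> x y" by (rule d2_ge_term)
        finally show False using y by simp
      qed
      then show "y \<in> {x \<in> full_shift. x i \<in> A}" using x y by (simp add: k_def)
    qed
    then show "\<exists>r>0. mball x r \<subseteq> {x \<in> full_shift. x i \<in> A}" using \<open>e > 0\<close> by blast
  qed auto
  show ?thesis
  proof
    have PiE_eq: "(\<Pi>\<^sub>E i\<in>(UNIV :: nat set). {1..}) = full_shift"
      by (auto simp: full_shift_def)
    have "sets shift_space = sigma_sets full_shift
        {{f \<in> full_shift. f i \<in> A} | i A. i \<in> UNIV \<and> A \<in> sets (count_space {1..})}"
      unfolding shift_space_def sets_PiM_single space_count_space PiE_eq ..
    also have "\<dots> \<subseteq> ?B"
      by (rule sigma_sets_mono') (auto simp: open_coord)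
    finally show "sets shift_space \<subseteq> ?B" .
  next
    have "U \<in> sets shift_space" if U: "openin mtopology U" for U
    proof -
      have "U = (\<Union>ys\<in>{ys. cylinder ys \<subseteq> U}. cylinder ys)"
      proof (intro equalityI subsetI)
        fix x assume x: "x \<in> U"
        then have xs: "x \<in> full_shift" using openin_subset[OF U] by auto
        obtain r where r: "r > 0" "mball x r \<subseteq> U"
          using U x unfolding openin_mtopology by auto
        have "(\<lambda>n. \<theta> ^ n / (1 - \<theta>)) \<longlonglongrightarrow> 0 / (1 - \<theta>)"
          by (intro tendsto_intros LIMSEQ_realpow_zero) (use \<theta> in auto)
        then have "\<forall>\<^sub>F n in sequentially. \<theta> ^ n / (1 - \<theta>) < r"
          using r(1) by (intro order_tendstoD) auto
        then obtain N where N: "\<theta> ^ N / (1 - \<theta>) < r" 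
          by (auto simp: eventually_sequentially)
        let ?ys = "map x [0..<N]"
        have "cylinder ?ys \<subseteq> mball x r"
        proof
          fix y assume y: "y \<in> cylinder ?ys"
          then have "d2 \<theta> \<alpha> x y \<le> \<theta> ^ N / (1 - \<theta>)"
            by (intro d2_le_of_prefix) (auto simp: cylinder_def)
          then show "y \<in> mball x r" using N xs y by (simp add: cylinder_def)
        qed
        moreover have "x \<in> cylinder ?ys" using xs by (simp add: cylinder_def)
        ultimately show "x \<in> (\<Union>ys\<in>{ys. cylinder ys \<subseteq> U}. cylinder ys)" using r(2) by blast
      qed blast
      also have "\<dots> \<in> sets shift_space"
        by (rule sets.countable_UN') (simp_all add: cylinder_in_sets image_subset_iff)
      finally show ?thesis .
    qed
    then show "?B \<subseteq> sets shift_space"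
      using sets.sigma_sets_subset[of "{U. openin mtopology U}" shift_space]
      by (auto simp: space_shift_space)
  qed
qed

end

end

theory Submission
  imports Defs
begin

text \<open>
  Both bounds come from comparing the covering time with the time that it takes to visit one ball of
  nearly minimal measure.  The lower bound (\<open>expected_covering_time_ge\<close>) is immediate: by stationarity,
  an orbit segment of length much shorter than the inverse of the measure of a ball is unlikely to
  visit that ball, hence is unlikely to be dense.

  The upper bound uses that the Gibbs measure is stationary and quasi-Bernoulli: the measure of
  \<open>[u v]\<close> agrees with \<open>\<mu> [u] * \<mu> [v]\<close> up to a constant factor
  (\<open>gibbs_measure_imp_quasi_bernoulli\<close>).  An orbit segment is \<open>\<delta>\<close>-dense as soon as it visits each set
  of a finite family of approximate balls of radius \<open>\<epsilon> \<delta>\<close>.  Each of them depends only on the first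
  \<open>n \<approx> log (1 / \<delta>)\<close> letters, and only about \<open>log (1 / \<delta>)\<close> different letters have to be distinguished
  in each coordinate, so there are roughly \<open>exp (log (1 / \<delta>) log log (1 / \<delta>))\<close> sets in the
  family.  If every set is visited in a window of length about \<open>1 / M\<close>, where \<open>M\<close> is the minimal ball
  measure at scale \<open>\<epsilon> \<delta>\<close>, with conditional probability bounded below given the past, then the
  probability that some set is not visited during \<open>r\<close> windows is at most the size of the family
  times \<open>q ^ r\<close> for some \<open>q < 1\<close>, and the expected covering time is at most \<open>1 / M\<close> times the
  logarithm of that size (\<open>expected_time_to_visit_all_le\<close>).

  The delicate point is that the window has length \<open>1 / M\<close> and not \<open>n / M\<close>, which would cost another
  factor \<open>log (1 / \<delta>)\<close>.  This is a second moment argument for the number of visits in the window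
  (\<open>prob_visit_ge\<close>).  It requires that visits do not cluster: a return to the set after \<open>j < n\<close> steps
  has exponentially small conditional probability in \<open>j\<close> (\<open>prob_return_le\<close>), because for small \<open>\<epsilon>\<close>
  the set omits the letter \<open>1\<close> or the letter \<open>2\<close> in each of its \<open>n\<close> coordinates.
\<close>

section \<open>Events determined by finitely many letters\<close>

text \<open>Cutting the preimage under \<open>\<sigma>\<^sup>k\<close> down to the shift keeps it inside the space of the measure.\<close>

definition after :: "nat \<Rightarrow> (nat \<Rightarrow> nat) set \<Rightarrow> (nat \<Rightarrow> nat) set" where
  "after k A = {x \<in> full_shift. (shift ^^ k) x \<in> A}"

text \<open>These events form the \<open>\<sigma>\<close>-algebra of the first \<open>n\<close> letters.  Its atoms are the countably many
  \<open>n\<close>-cylinders, so measurability of such an event comes for free.\<close>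

definition determined :: "nat \<Rightarrow> (nat \<Rightarrow> nat) set \<Rightarrow> bool" where
  "determined n A \<longleftrightarrow>
     A \<subseteq> full_shift \<and> (\<forall>x\<in>A. \<forall>y\<in>full_shift. (\<forall>i<n. y i = x i) \<longrightarrow> y \<in> A)"

lemma funpow_shift: "(shift ^^ k) x i = x (k + i)"
  by (induction k arbitrary: i) (auto simp: shift_def)

lemma funpow_shift_full_shift: "x \<in> full_shift \<Longrightarrow> (shift ^^ k) x \<in> full_shift"
  by (simp add: full_shift_def funpow_shift)

lemma funpow_shift_add: "(shift ^^ k) ((shift ^^ l) x) = (shift ^^ (k + l)) x"
  by (simp add: funpow_add)

lemma after_0 [simp]: "after 0 A = A \<inter> full_shift"
  by (auto simp: after_def)

lemma after_after: "after k (after l A) = after (k + l) A"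
  by (auto simp: after_def funpow_shift_full_shift funpow_shift_add add.commute)

lemma after_Int: "after k (A \<inter> B) = after k A \<inter> after k B"
  by (auto simp: after_def)

lemma after_UN: "after k (\<Union>i\<in>I. A i) = (\<Union>i\<in>I. after k (A i))"
  by (auto simp: after_def)

lemma determinedD_subset: "determined n A \<Longrightarrow> A \<subseteq> full_shift"
  by (simp add: determined_def)

lemma determined_mono: "determined n A \<Longrightarrow> n \<le> m \<Longrightarrow> determined m A"
  by (auto simp: determined_def)

lemma determined_Diff:
  assumes "determined n A" "determined n B" shows "determined n (A - B)"
  unfolding determined_def
proof (intro conjI ballI impI)
  show "A - B \<subseteq> full_shift" using assms by (auto simp: determined_def)
  fix x y assume *: "x \<in> A - B" "y \<in> full_shift" "\<forall>i<n. y i = x i"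
  then have "y \<in> A" using assms(1) by (auto simp: determined_def)
  moreover have "y \<notin> B"
  proof
    assume "y \<in> B"
    moreover have "x \<in> full_shift" using * determinedD_subset[OF assms(1)] by auto
    ultimately have "x \<in> B" using assms(2) * by (simp add: determined_def)
    then show False using * by simp
  qed
  ultimately show "y \<in> A - B" by simp
qed

lemma determined_UN: "(\<And>i. i \<in> I \<Longrightarrow> determined n (A i)) \<Longrightarrow> determined n (\<Union>i\<in>I. A i)"
  unfolding determined_def by blast

lemma determined_full_shift: "determined n full_shift"
  by (auto simp: determined_def)

lemma determined_after:
  assumes "determined n A" shows "determined (k + n) (after k A)"
  using assms unfolding determined_def after_def
  by (auto simp: funpow_shift funpow_shift_full_shift)

lemma determined_cylinder: "determined (length u) (cylinder u)"
  by (auto simp: determined_def cylinder_def)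

lemma determined_avoiding: "determined j {y \<in> full_shift. \<forall>i<j. y i \<noteq> b i}"
  by (auto simp: determined_def)

lemma cylinder_subset: "cylinder u \<subseteq> full_shift"
  by (auto simp: cylinder_def)

lemma cylinder_Nil [simp]: "cylinder [] = full_shift"
  by (auto simp: cylinder_def)

lemma cylinder_append: "cylinder (u @ v) = after (length u) (cylinder v) \<inter> cylinder u"
proof (intro set_eqI iffI)
  fix x assume x: "x \<in> cylinder (u @ v)"
  then have "\<forall>i<length v. x (length u + i) = v ! i" "\<forall>i<length u. x i = u ! i"
    by (auto simp: cylinder_def nth_append)
  then show "x \<in> after (length u) (cylinder v) \<inter> cylinder u"
    using x by (auto simp: cylinder_def after_def funpow_shift funpow_shift_full_shift)
next
  fix x assume x: "x \<in> after (length u) (cylinder v) \<inter> cylinder u"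
  then have *: "x (length u + i) = v ! i" if "i < length v" for i
    using that by (auto simp: cylinder_def after_def funpow_shift)
  have "x i = (u @ v) ! i" if "i < length (u @ v)" for i
    using *[of "i - length u"] x that by (auto simp: cylinder_def nth_append)
  then show "x \<in> cylinder (u @ v)" using x by (auto simp: cylinder_def)
qed

lemma determined_eq_UN_cylinder:
  assumes "determined n A"
  shows "A = (\<Union>u\<in>(\<lambda>x. map x [0..<n]) ` A. cylinder u)"
  using assms unfolding determined_def cylinder_def by (auto 0 3)

lemma space_shift_space: "space shift_space = full_shift"
  by (auto simp: shift_space_def space_PiM full_shift_def PiE_def)

lemma coordinate_measurable: "(\<lambda>x. x i) \<in> measurable shift_space (count_space {1..})"
  unfolding shift_space_def by (rule measurable_component_singleton[OF UNIV_I])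

lemma shift_measurable: "shift \<in> measurable shift_space shift_space"
proof -
  have "shift \<in> measurable shift_space (PiM UNIV (\<lambda>_. count_space {1..}))"
  proof (rule measurable_PiM_single')
    show "(\<lambda>\<omega>. shift \<omega> i) \<in> measurable shift_space (count_space {1..})" for i
      unfolding shift_def by (rule coordinate_measurable)
    show "shift \<in> space shift_space \<rightarrow> (\<Pi>\<^sub>E i\<in>UNIV. space (count_space {1..}))"
      by (auto simp: space_shift_space full_shift_def shift_def)
  qed
  then show ?thesis by (simp add: shift_space_def)
qed

lemma cylinder_sets: "cylinder u \<in> sets shift_space"
proof -
  have "{x \<in> space shift_space. x i = a} \<in> sets shift_space" for i a
  proof -
    have "(\<lambda>x. x i) -` ({a} \<inter> {1..}) \<inter> space shift_space \<in> sets shift_space"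
      by (rule measurable_sets[OF coordinate_measurable]) auto
    also have "(\<lambda>x. x i) -` ({a} \<inter> {1..}) \<inter> space shift_space = {x \<in> space shift_space. x i = a}"
      by (auto simp: space_shift_space full_shift_def)
    finally show ?thesis .
  qed
  then have "{x \<in> space shift_space. \<forall>i\<in>{..<length u}. x i = u ! i} \<in> sets shift_space"
    by (intro sets.sets_Collect_finite_All) auto
  then show ?thesis unfolding cylinder_def space_shift_space Ball_def lessThan_iff .
qed

lemma determined_sets: "determined n A \<Longrightarrow> A \<in> sets shift_space"
  by (subst determined_eq_UN_cylinder, assumption, rule sets.countable_UN'[OF countableI_type])
     (auto simp: cylinder_sets)

lemma after_sets:
  assumes "A \<in> sets shift_space" shows "after k A \<in> sets shift_space"
proof -
  have "shift ^^ k \<in> measurable shift_space shift_space"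
  proof (induction k)
    case (Suc k)
    from measurable_comp[OF this shift_measurable] show ?case by (simp add: o_def)
  qed (simp add: id_def)
  from measurable_sets[OF this assms] show ?thesis
    by (simp add: after_def space_shift_space Int_def vimage_def conj_commute)
qed

section \<open>Quasi-Bernoulli measures\<close>

text \<open>Quasi-independence of consecutive blocks replaces the independence of Bernoulli measures.  Stated
  for words of every length with one constant \<open>Q\<close>, it passes to all events determined by finitely many
  letters.\<close>

locale quasi_bernoulli_shift = prob_space M for M :: "(nat \<Rightarrow> nat) measure" +
  fixes Q :: real
  assumes sets_M: "sets M = sets shift_space"
    and invariant: "distr M M shift = M"
    and Q_gt_1: "1 < Q"
    and cylinder_pos: "set u \<subseteq> {1..} \<Longrightarrow> 0 < prob (cylinder u)"
    and cylinder_append_le: "set u \<subseteq> {1..} \<Longrightarrow> set v \<subseteq> {1..} \<Longrightarrow>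
      prob (cylinder (u @ v)) \<le> Q * prob (cylinder u) * prob (cylinder v)"
    and cylinder_append_ge: "set u \<subseteq> {1..} \<Longrightarrow> set v \<subseteq> {1..} \<Longrightarrow>
      prob (cylinder u) * prob (cylinder v) \<le> Q * prob (cylinder (u @ v))"
begin

lemma space_M: "space M = full_shift"
  using sets_eq_imp_space_eq[OF sets_M] by (simp add: space_shift_space)

lemma prob_full_shift: "prob full_shift = 1"
  using prob_space by (simp add: space_M)

lemma prob_after:
  assumes A: "A \<in> sets M" shows "prob (after k A) = prob A"
proof (induction k)
  case 0
  have "A \<inter> full_shift = A" using sets.sets_into_space[OF A] by (auto simp: space_M)
  then show ?case by simp
next
  case (Suc k)
  have s: "after k A \<in> sets M" using after_sets A by (simp add: sets_M)
  have m: "shift \<in> measurable M M"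
    using shift_measurable by (simp add: measurable_cong_sets[OF sets_M sets_M])
  have "prob (after k A) = measure (distr M M shift) (after k A)" by (simp add: invariant)
  also have "\<dots> = prob (shift -` after k A \<inter> space M)"
    by (rule measure_distr[OF m s])
  also have "shift -` after k A \<inter> space M = after (Suc k) A"
    using funpow_shift_full_shift[of _ 1]
    by (auto simp: after_def space_M funpow_Suc_right simp del: funpow.simps)
  finally show ?case using Suc by simp
qed

text \<open>An inequality that holds for all \<open>n\<close>-cylinders can be summed over the cylinders that make up an
  event \<open>A\<close>.  The shifts \<open>k\<close>, \<open>l\<close> and the fixed events \<open>F\<close>, \<open>F'\<close> allow \<open>A\<close> to be placed before as
  well as after a given event.\<close>

lemma compare_determined:
  assumes A: "determined n A" and F: "F \<in> sets M" "F' \<in> sets M" and c: "0 \<le> c"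
    and le: "\<And>u. set u \<subseteq> {1..} \<Longrightarrow> length u = n \<Longrightarrow>
      prob (after k (cylinder u) \<inter> F) \<le> c * prob (after l (cylinder u) \<inter> F')"
  shows "prob (after k A \<inter> F) \<le> c * prob (after l A \<inter> F')"
proof -
  let ?W = "(\<lambda>x. map x [0..<n]) ` A"
  have decomp: "emeasure M (after k A \<inter> F)
      = (\<integral>\<^sup>+u. emeasure M (after k (cylinder u) \<inter> F) \<partial>count_space ?W)"
    if "F \<in> sets M" for k F
  proof -
    have "after k A \<inter> F = (\<Union>u\<in>?W. after k (cylinder u) \<inter> F)"
      using after_UN[of k cylinder ?W] determined_eq_UN_cylinder[OF A] by auto
    also have "emeasure M \<dots> = (\<integral>\<^sup>+u. emeasure M (after k (cylinder u) \<inter> F) \<partial>count_space ?W)"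
    proof (rule emeasure_UN_countable)
      show "after k (cylinder u) \<inter> F \<in> sets M" for u
        using that after_sets[OF cylinder_sets] by (auto simp: sets_M)
      have "u = map x [0..<n]" if "u \<in> ?W" "x \<in> cylinder u" for u x
      proof (rule nth_equalityI)
        show "length u = length (map x [0..<n])" using that(1) by auto
        then show "u ! i = map x [0..<n] ! i" if "i < length u" for i
          using \<open>x \<in> cylinder u\<close> that by (simp add: cylinder_def)
      qed
      then have "u = v" if "u \<in> ?W" "v \<in> ?W" "x \<in> cylinder u" "x \<in> cylinder v" for u v x
        using that by metis
      then show "disjoint_family_on (\<lambda>u. after k (cylinder u) \<inter> F) ?W"
        unfolding disjoint_family_on_def after_def by blast
    qed auto
    finally show ?thesis .
  qed
  have "emeasure M (after k A \<inter> F)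
      \<le> (\<integral>\<^sup>+u. ennreal c * emeasure M (after l (cylinder u) \<inter> F') \<partial>count_space ?W)"
    unfolding decomp[OF F(1)]
  proof (rule nn_integral_mono, unfold space_count_space)
    fix u assume u: "u \<in> ?W"
    then have "set u \<subseteq> {1..}" "length u = n"
      using determinedD_subset[OF A] by (fastforce simp: full_shift_def)+
    from ennreal_leI[OF le[OF this]]
    show "emeasure M (after k (cylinder u) \<inter> F)
        \<le> ennreal c * emeasure M (after l (cylinder u) \<inter> F')"
      by (simp add: emeasure_eq_measure ennreal_mult c)
  qed
  also have "\<dots> = ennreal c * emeasure M (after l A \<inter> F')"
    by (subst nn_integral_cmult) (auto simp: decomp[OF F(2)])
  finally show ?thesis
    by (simp add: emeasure_eq_measure ennreal_mult[symmetric] c)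
qed

lemma determined_sets_M: "determined n A \<Longrightarrow> A \<in> sets M"
  by (simp add: sets_M determined_sets)

lemma after_sets_M: "A \<in> sets M \<Longrightarrow> after k A \<in> sets M"
  by (simp add: sets_M after_sets)

lemma full_shift_sets: "full_shift \<in> sets M"
  by (rule determined_sets_M[OF determined_full_shift])

text \<open>The estimate for a pair of cylinders is summed first over the cylinders in \<open>B\<close>, with the first
  block fixed, and then over those in \<open>A\<close>.\<close>

lemma prob_Int_after_le:
  assumes A: "determined n A" and B: "determined m B"
  shows "prob (A \<inter> after n B) \<le> Q * prob A * prob B"
proof -
  note s = cylinder_sets[folded sets_M] full_shift_sets
  have AB: "A \<subseteq> full_shift" "B \<subseteq> full_shift" using A B by (auto dest: determinedD_subset)
  have 1: "prob (cylinder u \<inter> after n B) \<le> Q * prob B * prob (cylinder u)"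
    if u: "set u \<subseteq> {1..}" "length u = n" for u
  proof -
    have "prob (after n B \<inter> cylinder u)
        \<le> (Q * prob (cylinder u)) * prob (after 0 B \<inter> full_shift)"
    proof (rule compare_determined[OF B s])
      fix v :: "nat list" assume v: "set v \<subseteq> {1..}"
      show "prob (after n (cylinder v) \<inter> cylinder u)
          \<le> Q * prob (cylinder u) * prob (after 0 (cylinder v) \<inter> full_shift)"
        using cylinder_append_le[OF u(1) v] u(2) cylinder_append[of u v] cylinder_subset[of v]
        by (simp add: Int_absorb2)
    qed (use Q_gt_1 in simp)
    then show ?thesis using AB by (simp add: Int_absorb2 Int_commute mult.commute mult.left_commute)
  qed
  have "prob (after 0 A \<inter> after n B) \<le> (Q * prob B) * prob (after 0 A \<inter> full_shift)"
    by (rule compare_determined[OF A])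
       (use 1 Q_gt_1 in \<open>auto intro: after_sets_M determined_sets_M[OF B] full_shift_sets
         simp: Int_absorb2[OF cylinder_subset]\<close>)
  then show ?thesis using AB by (simp add: Int_absorb2 mult.commute mult.left_commute)
qed

lemma prob_Int_after_ge:
  assumes A: "determined n A" and B: "determined m B"
  shows "prob A * prob B \<le> Q * prob (A \<inter> after n B)"
proof (cases "prob B = 0")
  case True
  then show ?thesis using Q_gt_1 by simp
next
  case False
  then have B0: "0 < prob B" using measure_nonneg[of M B] by linarith
  note s = cylinder_sets[folded sets_M] full_shift_sets
  have AB: "A \<subseteq> full_shift" "B \<subseteq> full_shift" using A B by (auto dest: determinedD_subset)
  have 1: "prob (cylinder u) \<le> Q / prob B * prob (cylinder u \<inter> after n B)"
    if u: "set u \<subseteq> {1..}" "length u = n" for u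
  proof -
    note u0 = cylinder_pos[OF u(1)]
    have "prob (after 0 B \<inter> full_shift)
        \<le> (Q / prob (cylinder u)) * prob (after n B \<inter> cylinder u)"
    proof (rule compare_determined[OF B s(2,1)])
      fix v :: "nat list" assume v: "set v \<subseteq> {1..}"
      show "prob (after 0 (cylinder v) \<inter> full_shift)
          \<le> Q / prob (cylinder u) * prob (after n (cylinder v) \<inter> cylinder u)"
        using cylinder_append_ge[OF u(1) v] u(2) cylinder_append[of u v] cylinder_subset[of v] u0
        by (simp add: Int_absorb2 field_simps)
    qed (use Q_gt_1 u0 in simp)
    then show ?thesis using AB u0 B0 by (simp add: Int_absorb2 Int_commute field_simps)
  qed
  have "prob (after 0 A \<inter> full_shift) \<le> (Q / prob B) * prob (after 0 A \<inter> after n B)"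
    by (rule compare_determined[OF A])
       (use 1 Q_gt_1 B0 in \<open>auto intro: after_sets_M determined_sets_M[OF B] full_shift_sets
         simp: Int_absorb2[OF cylinder_subset]\<close>)
  then show ?thesis using AB B0 by (simp add: Int_absorb2 field_simps)
qed

end


section \<open>Visiting a small set within the expected waiting time\<close>

text \<open>The Paley--Zygmund argument: a count whose second moment is comparable to the square of its mean
  cannot be concentrated on an event of small probability.\<close>

lemma (in prob_space) prob_UN_ge_second_moment:
  fixes E :: "'i \<Rightarrow> 'a set"
  assumes I: "finite I" and E: "\<And>i. i \<in> I \<Longrightarrow> E i \<in> events"
    and B: "0 < B" and m: "0 < m" "m = (\<Sum>i\<in>I. prob (E i))"
    and second: "(\<Sum>i\<in>I. \<Sum>j\<in>I. prob (E i \<inter> E j)) \<le> B * m\<^sup>2"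
  shows "1 / B \<le> prob (\<Union>i\<in>I. E i)"
proof -
  define N where "N x = (\<Sum>i\<in>I. indicat_real (E i) x)" for x
  define s where "s = B * m"
  let ?H = "\<Union>i\<in>I. E i"
  have H: "?H \<in> events" using I E by auto
  have int: "integrable M (indicat_real A)" "expectation (indicat_real A) = prob A"
    if "A \<in> events" for A
    using that by (auto simp: integrable_indicator_iff emeasure_eq_measure)
  have N2: "(N x)\<^sup>2 = (\<Sum>i\<in>I. \<Sum>j\<in>I. indicat_real (E i \<inter> E j) x)" for x
    by (simp add: N_def power2_eq_square sum_product indicator_inter_arith)
  have pw: "2 * s * N x \<le> (N x)\<^sup>2 + s\<^sup>2 * indicat_real ?H x" for x
  proof (cases "x \<in> ?H")
    case True
    \<comment> \<open>Expanding a square replaces Cauchy--Schwarz; \<open>s = B * m\<close> is the optimal center if the second moment is \<open>B * m\<^sup>2\<close>.\<close>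
    have "0 \<le> (N x - s)\<^sup>2" by simp
    then show ?thesis using True by (simp add: power2_diff mult.commute mult.left_commute)
  next
    case False
    then have "N x = 0" by (simp add: N_def)
    then show ?thesis using False by simp
  qed
  have EN: "integrable M N" "expectation N = m"
    unfolding N_def m using int E by (auto simp: Bochner_Integration.integral_sum)
  have EN2: "integrable M (\<lambda>x. (N x)\<^sup>2)"
      "expectation (\<lambda>x. (N x)\<^sup>2) = (\<Sum>i\<in>I. \<Sum>j\<in>I. prob (E i \<inter> E j))"
    unfolding N2 using int E by (auto simp: Bochner_Integration.integral_sum sets.Int)
  have "2 * s * expectation N = expectation (\<lambda>x. 2 * s * N x)" by simp
  also have "\<dots> \<le> expectation (\<lambda>x. (N x)\<^sup>2 + s\<^sup>2 * indicat_real ?H x)"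
    by (rule integral_mono) (use EN EN2 int[OF H] pw in auto)
  also have "\<dots> = expectation (\<lambda>x. (N x)\<^sup>2) + s\<^sup>2 * prob ?H"
    using EN2 int[OF H] by simp
  finally have "2 * s * m \<le> B * m\<^sup>2 + s\<^sup>2 * prob ?H" using EN EN2 second by simp
  then have "(B * m\<^sup>2) * 1 \<le> (B * m\<^sup>2) * (B * prob ?H)"
    by (simp add: s_def power2_eq_square algebra_simps)
  moreover have "0 < B * m\<^sup>2" using B m(1) by simp
  ultimately have "1 \<le> B * prob ?H" by (rule mult_left_le_imp_le)
  then show ?thesis using B by (simp add: field_simps)
qed

text \<open>A set whose \<open>i\<close>-th letters omit \<open>1\<close> or \<open>2\<close>.  Two fixed letters suffice because balls of small
  radius cannot contain both values in one coordinate; restricting to them makes the probability of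
  the missing letter bounded away from \<open>0\<close>.\<close>

definition misses_letter :: "nat \<Rightarrow> (nat \<Rightarrow> nat) set \<Rightarrow> bool" where
  "misses_letter i A \<longleftrightarrow> (\<exists>b\<in>{1, 2}. \<forall>x\<in>A. x i \<noteq> b)"

lemma misses_letterE:
  assumes "\<And>i. i < n \<Longrightarrow> misses_letter i A"
  obtains b where "\<And>i. i < n \<Longrightarrow> b i \<in> {1, 2}" "\<And>i x. i < n \<Longrightarrow> x \<in> A \<Longrightarrow> x i \<noteq> b i"
proof -
  have "\<forall>i. \<exists>b. i < n \<longrightarrow> b \<in> {1, 2} \<and> (\<forall>x\<in>A. x i \<noteq> b)"
    using assms unfolding misses_letter_def by blast
  from choice[OF this] that show thesis by blast
qed

lemma sum_geometric_shifted_le: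
  fixes \<rho> :: real
  assumes "0 < \<rho>" "\<rho> < 1"
  shows "(\<Sum>l<T. if k \<le> l then \<rho> ^ (l - k) else 0) \<le> 1 / (1 - \<rho>)"
proof -
  have "(\<Sum>l<T. if k \<le> l then \<rho> ^ (l - k) else 0) * (1 - \<rho>) \<le> 1 - \<rho> ^ (T - k)"
  proof (induction T)
    case (Suc T)
    show ?case
    proof (cases "k \<le> T")
      case True
      then have "Suc T - k = Suc (T - k)" by simp
      then show ?thesis using True Suc by (simp add: algebra_simps)
    qed (use Suc in simp)
  qed simp
  also have "\<dots> \<le> 1" using assms by simp
  finally show ?thesis using assms by (simp add: field_simps)
qed

context quasi_bernoulli_shift
begin

text \<open>Given any past, the next letter is the forbidden one with conditional probability at least
  \<open>min (\<mu> [1]) (\<mu> [2]) / Q\<close>, so forbidding it multiplies the probability by at most this factor.\<close>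

definition decay_rate :: real where
  "decay_rate = 1 - min (prob (cylinder [1])) (prob (cylinder [2])) / Q"

lemma decay_rate: "0 < decay_rate" "decay_rate < 1"
proof -
  have "0 < prob (cylinder [1])" "0 < prob (cylinder [2])"
    by (auto intro!: cylinder_pos)
  moreover have "min (prob (cylinder [1])) (prob (cylinder [2])) \<le> 1" by (simp add: min.coboundedI1)
  then have "min (prob (cylinder [1])) (prob (cylinder [2])) < Q" using Q_gt_1 by linarith
  ultimately show "0 < decay_rate" "decay_rate < 1"
    using Q_gt_1 unfolding decay_rate_def by auto
qed

lemma prob_avoiding_le:
  assumes "\<And>i. i < j \<Longrightarrow> b i \<in> {1, 2}"
  shows "prob {y \<in> full_shift. \<forall>i<j. y i \<noteq> b i} \<le> decay_rate ^ j"
  using assms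
proof (induction j)
  case 0
  then show ?case by (simp add: prob_full_shift)
next
  case (Suc j)
  let ?E = "\<lambda>j. {y \<in> full_shift. \<forall>i<j. y i \<noteq> b i}"
  let ?R = "?E j \<inter> after j (cylinder [b j])"
  let ?p = "min (prob (cylinder [1])) (prob (cylinder [2]))"
  have E: "?E j \<in> sets M" by (rule determined_sets_M[OF determined_avoiding])
  have R: "?R \<in> sets M"
    by (intro sets.Int E after_sets_M) (simp add: sets_M cylinder_sets)
  have "b j \<in> {1, 2}" using Suc.prems by simp
  then have "?p \<le> prob (cylinder [b j])" by auto
  then have "prob (?E j) * ?p \<le> prob (?E j) * prob (cylinder [b j])"
    by (rule mult_left_mono) simp
  also have "\<dots> \<le> Q * prob ?R"
    by (rule prob_Int_after_ge[OF determined_avoiding determined_cylinder])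
  finally have *: "prob (?E j) * ?p / Q \<le> prob ?R"
    using Q_gt_1 by (simp add: field_simps)
  have "x j \<noteq> b j" if "x \<in> ?E (Suc j)" for x using that by simp
  moreover have "x j = b j" if "x \<in> ?R" for x
    using that by (simp add: after_def cylinder_def funpow_shift)
  ultimately have "?E (Suc j) \<subseteq> ?E j - ?R" by fastforce
  then have "prob (?E (Suc j)) \<le> prob (?E j - ?R)"
    by (rule finite_measure_mono[OF _ sets.Diff[OF E R]])
  also have "\<dots> = prob (?E j) - prob ?R"
    by (rule finite_measure_Diff[OF E R Int_lower1])
  also have "\<dots> \<le> prob (?E j) * decay_rate"
    using * by (simp add: decay_rate_def algebra_simps)
  also have "\<dots> \<le> decay_rate ^ j * decay_rate"
    using Suc decay_rate by (intro mult_right_mono) auto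
  finally show ?case unfolding power_Suc2 .
qed

lemma prob_misses_letter_le:
  assumes A: "determined n A" and miss: "\<And>i. i < n \<Longrightarrow> misses_letter i A"
  shows "prob A \<le> decay_rate ^ n"
proof -
  obtain b where b: "\<And>i. i < n \<Longrightarrow> b i \<in> {1, 2}" "\<And>i x. i < n \<Longrightarrow> x \<in> A \<Longrightarrow> x i \<noteq> b i"
    using misses_letterE[OF miss] by metis
  have "prob A \<le> prob {y \<in> full_shift. \<forall>i<n. y i \<noteq> b i}"
    using b(2) determinedD_subset[OF A]
    by (intro finite_measure_mono determined_sets_M[OF determined_avoiding]) auto
  then show ?thesis using prob_avoiding_le[of n b] b(1) by fastforce
qed

text \<open>For \<open>j \<ge> n\<close> the two visits are quasi-independent.  For \<open>j < n\<close> the two windows overlap: a return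
  after \<open>j\<close> steps forces the \<open>j\<close> letters that follow the first window to avoid the letters missed by
  the last \<open>j\<close> coordinates of \<open>A\<close>, which costs a factor exponentially small in \<open>j\<close>.\<close>

lemma prob_return_le:
  assumes A: "determined n A" and miss: "\<And>i. i < n \<Longrightarrow> misses_letter i A"
  shows "prob (A \<inter> after j A) \<le> Q * prob A * decay_rate ^ j + Q * prob A * prob A"
proof (cases "n \<le> j")
  case True
  have "prob (A \<inter> after j A) \<le> Q * prob A * prob A"
    by (rule prob_Int_after_le[OF determined_mono[OF A True] A])
  moreover have "0 \<le> Q * prob A * decay_rate ^ j"
    using Q_gt_1 decay_rate by auto
  ultimately show ?thesis by linarith
next
  case False
  obtain b where b: "\<And>i. i < n \<Longrightarrow> b i \<in> {1, 2}" "\<And>i x. i < n \<Longrightarrow> x \<in> A \<Longrightarrow> x i \<noteq> b i"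
    using misses_letterE[OF miss] by metis
  \<comment> \<open>Letter \<open>n + i\<close> is coordinate \<open>n - j + i\<close> of the second, shifted window.\<close>
  define b' where "b' i = b (n - j + i)" for i
  let ?D = "{y \<in> full_shift. \<forall>i<j. y i \<noteq> b' i}"
  have "A \<inter> after j A \<subseteq> A \<inter> after n ?D"
  proof
    fix x assume x: "x \<in> A \<inter> after j A"
    have "x (n + i) \<noteq> b' i" if "i < j" for i
      using b(2)[of "n - j + i" "(shift ^^ j) x"] x that False
      by (simp add: after_def funpow_shift b'_def)
    then show "x \<in> A \<inter> after n ?D"
      using x by (auto simp: after_def funpow_shift funpow_shift_full_shift)
  qed
  then have "prob (A \<inter> after j A) \<le> prob (A \<inter> after n ?D)"
    by (intro finite_measure_mono sets.Int after_sets_M determined_sets_M[OF A]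
        determined_sets_M[OF determined_avoiding])
  also have "\<dots> \<le> Q * prob A * prob ?D"
    by (rule prob_Int_after_le[OF A determined_avoiding])
  also have "\<dots> \<le> Q * prob A * decay_rate ^ j"
    using Q_gt_1 b(1) False by (intro mult_left_mono prob_avoiding_le) (auto simp: b'_def)
  also have "\<dots> \<le> Q * prob A * decay_rate ^ j + Q * prob A * prob A"
    using Q_gt_1 by simp
  finally show ?thesis .
qed

text \<open>The constant by which the second moment of the number of visits may exceed its squared mean:
  \<open>Q\<close> comes from distant pairs of visits, the rest from clustered ones.\<close>

definition spread :: real where
  "spread = Q * (1 + 2 / (1 - decay_rate))"

lemma spread_pos: "0 < spread"
proof -
  have "0 < 1 + 2 / (1 - decay_rate)" using decay_rate by (intro add_pos_pos) auto
  then show ?thesis using Q_gt_1 unfolding spread_def by (intro mult_pos_pos) auto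
qed

text \<open>By the exponentially small return probabilities, the visits in a window cluster only boundedly, so
  the second moment method applies.  Counting visits at \<^emph>\<open>all\<close> times, and not only at multiples of \<open>n\<close>,
  is what makes a window of length about \<open>1 / prob A\<close> sufficient; testing only disjoint
  blocks of length \<open>n\<close> would require a window \<open>n\<close> times as long.\<close>

lemma prob_visit_ge:
  assumes A: "determined n A" and miss: "\<And>i. i < n \<Longrightarrow> misses_letter i A"
    and T: "1 \<le> real T * prob A"
  shows "1 / spread \<le> prob (\<Union>k<T. after k A)"
proof (rule prob_UN_ge_second_moment)
  define \<rho> where "\<rho> = decay_rate"
  define a where "a k l = (if k \<le> l then \<rho> ^ (l - k) else 0)" for k l :: nat
  define p where "p = prob A"
  have sA: "A \<in> sets M" by (rule determined_sets_M[OF A])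
  have rho: "0 < \<rho>" "\<rho> < 1" using decay_rate by (auto simp: \<rho>_def)
  have Qp: "0 \<le> Q * p" using Q_gt_1 by (simp add: p_def)
  show "finite {..<T}" "0 < spread" by (simp_all add: spread_pos)
  show "after k A \<in> events" for k by (rule after_sets_M[OF sA])
  show "0 < real T * p" using T by (simp add: p_def)
  show "real T * p = (\<Sum>k<T. prob (after k A))" by (simp add: prob_after[OF sA] p_def)
  have pair: "prob (after k A \<inter> after l A) \<le> Q * p * (a k l + a l k) + Q * p * p" for k l
  proof -
    have le: "prob (after k A \<inter> after l A) \<le> Q * p * (a k l + a l k) + Q * p * p"
      if "k \<le> l" for k l
    proof -
      have "after k A \<inter> after l A = after k (A \<inter> after (l - k) A)"
        using that by (simp add: after_Int after_after)
      then have "prob (after k A \<inter> after l A) = prob (A \<inter> after (l - k) A)"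
        using prob_after[of "A \<inter> after (l - k) A" k] sA after_sets_M by auto
      also have "\<dots> \<le> Q * p * a k l + Q * p * p"
        using prob_return_le[OF A miss, of "l - k"] that by (simp add: a_def p_def \<rho>_def)
      also have "\<dots> \<le> Q * p * (a k l + a l k) + Q * p * p"
        using Qp rho by (intro add_mono mult_left_mono) (auto simp: a_def)
      finally show ?thesis .
    qed
    show ?thesis using le[of k l] le[of l k] by (cases "k \<le> l") (auto simp: Int_commute add.commute)
  qed
  have row: "(\<Sum>k<T. \<Sum>l<T. a k l) \<le> real T * (1 / (1 - \<rho>))"
  proof -
    have "(\<Sum>l<T. a k l) \<le> 1 / (1 - \<rho>)" for k
      unfolding a_def by (rule sum_geometric_shifted_le[OF rho])
    from sum_bounded_above[of "{..<T}", OF this] show ?thesis by simp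
  qed
  have "(\<Sum>k<T. \<Sum>l<T. a k l + a l k) = (\<Sum>k<T. \<Sum>l<T. a k l) + (\<Sum>k<T. \<Sum>l<T. a k l)"
    using sum.swap[of "\<lambda>k l. a l k" "{..<T}" "{..<T}"] by (simp add: sum.distrib)
  also have "\<dots> \<le> real T * (1 / (1 - \<rho>)) + real T * (1 / (1 - \<rho>))"
    by (rule add_mono[OF row row])
  also have "\<dots> = real T * (2 / (1 - \<rho>))"
    by (simp add: field_simps)
  finally have both: "(\<Sum>k<T. \<Sum>l<T. a k l + a l k) \<le> real T * (2 / (1 - \<rho>))" .
  have "(\<Sum>k<T. \<Sum>l<T. prob (after k A \<inter> after l A))
      \<le> (\<Sum>k<T. \<Sum>l<T. Q * p * (a k l + a l k) + Q * p * p)"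
    by (intro sum_mono pair)
  also have "\<dots> = Q * p * (\<Sum>k<T. \<Sum>l<T. a k l + a l k) + Q * (real T * p)\<^sup>2"
    by (simp add: sum.distrib sum_distrib_left power2_eq_square algebra_simps)
  also have "\<dots> \<le> Q * p * (real T * (2 / (1 - \<rho>))) + Q * (real T * p)\<^sup>2"
    by (rule add_right_mono[OF mult_left_mono[OF both Qp]])
  also have "\<dots> = Q * (2 / (1 - \<rho>)) * (real T * p) + Q * (real T * p)\<^sup>2" by simp
  also have "\<dots> \<le> Q * (2 / (1 - \<rho>)) * (real T * p)\<^sup>2 + Q * (real T * p)\<^sup>2"
  proof (rule add_right_mono[OF mult_left_mono])
    show "real T * p \<le> (real T * p)\<^sup>2"
      using T self_le_power[of "real T * p" 2] by (simp add: p_def)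
    show "0 \<le> Q * (2 / (1 - \<rho>))" using Q_gt_1 rho by simp
  qed
  also have "\<dots> = spread * (real T * p)\<^sup>2"
    by (simp add: spread_def \<rho>_def algebra_simps)
  finally show "(\<Sum>k<T. \<Sum>l<T. prob (after k A \<inter> after l A)) \<le> spread * (real T * p)\<^sup>2" .
qed

definition never_in :: "(nat \<Rightarrow> nat) set \<Rightarrow> nat \<Rightarrow> nat \<Rightarrow> (nat \<Rightarrow> nat) set" where
  "never_in H L r = {x \<in> full_shift. \<forall>i<r. (shift ^^ (i * L)) x \<notin> H}"

lemma never_in_Suc: "never_in H L (Suc r) = never_in H L r - after (r * L) H"
  by (auto simp: never_in_def after_def less_Suc_eq)

lemma determined_never_in:
  assumes H: "determined L H" shows "determined (r * L) (never_in H L r)"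
proof (induction r)
  case 0
  then show ?case by (simp add: never_in_def determined_full_shift)
next
  case (Suc r)
  have "determined (r * L + L) (never_in H L r - after (r * L) H)"
    by (intro determined_Diff determined_after[OF H] determined_mono[OF Suc]) simp
  then show ?case by (simp add: never_in_Suc add.commute)
qed

text \<open>\<open>H\<close> is decided within one block of length \<open>L\<close>, and by quasi-independence each new block realises
  \<open>H\<close> with conditional probability at least \<open>h / Q\<close>, whatever the past.\<close>

lemma prob_never_in_le:
  assumes H: "determined L H" and h: "h \<le> prob H"
  shows "prob (never_in H L r) \<le> (1 - h / Q) ^ r"
proof (induction r)
  case 0
  then show ?case by (simp add: never_in_def prob_full_shift)
next
  case (Suc r)
  let ?G = "never_in H L r"
  note G = determined_never_in[OF H, of r]
  have s: "?G \<in> sets M" "after (r * L) H \<in> sets M"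
    using determined_sets_M[OF G] after_sets_M[OF determined_sets_M[OF H]] by auto
  have "h \<le> 1" using h by (meson order_trans prob_le_1)
  then have q: "0 \<le> 1 - h / Q" using Q_gt_1 by (simp add: field_simps)
  have "prob ?G * h \<le> prob ?G * prob H" using h by (intro mult_left_mono) auto
  also have "\<dots> \<le> Q * prob (?G \<inter> after (r * L) H)"
    by (rule prob_Int_after_ge[OF G H])
  finally have *: "prob ?G * h / Q \<le> prob (?G \<inter> after (r * L) H)"
    using Q_gt_1 by (simp add: field_simps)
  have "prob (never_in H L (Suc r)) = prob ?G - prob (?G \<inter> after (r * L) H)"
    unfolding never_in_Suc using s by (intro finite_measure_Diff') auto
  also have "\<dots> \<le> prob ?G * (1 - h / Q)" using * by (simp add: algebra_simps)
  also have "\<dots> \<le> (1 - h / Q) ^ r * (1 - h / Q)" by (rule mult_right_mono[OF Suc q])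
  finally show ?case unfolding power_Suc2 .
qed

end

section \<open>Visiting all sets of a finite family\<close>

text \<open>\<open>U r\<close> stands for the event that the time exceeds \<open>r\<close> blocks.  The first \<open>r0\<close> blocks, about
  \<open>log N\<close> many, are needed to beat the factor \<open>N\<close> of a union bound; from there on the tail is
  geometric.\<close>

lemma (in prob_space) nn_integral_time_le:
  fixes \<tau> :: "'a \<Rightarrow> ennreal" and N q :: real
  assumes U: "\<And>r. U r \<in> events"
    and prob: "\<And>r. prob (U r) \<le> N * q ^ r" and q: "0 \<le> q" "q < 1" and N: "0 \<le> N"
    and r0: "1 \<le> r0" "N * q ^ r0 \<le> 1" and L: "0 < L"
    and \<tau>: "\<And>x r. x \<in> space M \<Longrightarrow> 1 \<le> r \<Longrightarrow> x \<notin> U r \<Longrightarrow> \<tau> x \<le> of_nat (r * L)"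
  shows "(\<integral>\<^sup>+x. \<tau> x \<partial>M) \<le> ennreal (real L * (real r0 + 1 / (1 - q)))"
proof -
  define S where "S x = (\<Sum>r. indicator (U (r0 + r)) x :: ennreal)" for x
  have pw: "\<tau> x \<le> of_nat L * (of_nat r0 + S x)" if x: "x \<in> space M" for x
  proof (cases "\<exists>r. x \<notin> U (r0 + r)")
    case True
    define r where "r = (LEAST r. x \<notin> U (r0 + r))"
    have r: "x \<notin> U (r0 + r)" unfolding r_def using True by (rule LeastI_ex)
    have "x \<in> U (r0 + i)" if "i < r" for i
      using not_less_Least[OF that[unfolded r_def]] by simp
    then have "of_nat r = (\<Sum>i<r. indicator (U (r0 + i)) x :: ennreal)" by simp
    also have "\<dots> \<le> S x" unfolding S_def by (rule sum_le_suminf) auto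
    finally have "of_nat (r0 + r) \<le> of_nat r0 + S x" by simp
    then have "of_nat L * (of_nat (r0 + r) :: ennreal) \<le> of_nat L * (of_nat r0 + S x)"
      by (rule mult_left_mono) simp
    with \<tau>[OF x _ r] r0(1) show ?thesis by (simp add: mult.commute)
  next
    case False
    \<comment> \<open>Here \<open>x\<close> lies in every event from \<open>r0\<close> on, and the bounding series diverges.\<close>
    have "of_nat n \<le> S x" for n
    proof -
      have "of_nat n = (\<Sum>i<n. indicator (U (r0 + i)) x :: ennreal)" using False by simp
      also have "\<dots> \<le> S x" unfolding S_def by (rule sum_le_suminf) auto
      finally show ?thesis .
    qed
    then have "\<top> \<le> S x" unfolding ennreal_SUP_of_nat_eq_top[symmetric] by (rule SUP_least)
    then show ?thesis using L by (simp add: top_unique ennreal_mult_top)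
  qed
  have "(\<integral>\<^sup>+x. \<tau> x \<partial>M) \<le> (\<integral>\<^sup>+x. of_nat L * (of_nat r0 + S x) \<partial>M)"
    by (intro nn_integral_mono pw)
  also have "\<dots> = of_nat L * (of_nat r0 + (\<Sum>r. emeasure M (U (r0 + r))))"
    unfolding S_def using U
    by (subst nn_integral_cmult, (simp; fail), subst nn_integral_add)
       (auto simp: nn_integral_suminf emeasure_space_1)
  also have "\<dots> \<le> of_nat L * (of_nat r0 + (\<Sum>r. ennreal (q ^ r)))"
  proof (intro mult_left_mono add_left_mono suminf_le)
    fix r
    have "prob (U (r0 + r)) \<le> (N * q ^ r0) * q ^ r"
      using prob[of "r0 + r"] by (simp add: power_add mult.assoc)
    also have "\<dots> \<le> q ^ r" using r0(2) q(1) mult_right_mono[of "N * q ^ r0" 1 "q ^ r"] by simp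
    finally show "emeasure M (U (r0 + r)) \<le> ennreal (q ^ r)"
      by (simp add: emeasure_eq_measure ennreal_leI)
  qed auto
  also have "(\<Sum>r. ennreal (q ^ r)) = ennreal (1 / (1 - q))"
    using q suminf_geometric[of q] by (subst suminf_ennreal2) (auto simp: summable_geometric)
  also have "of_nat L * (of_nat r0 + ennreal (1 / (1 - q)))
      = ennreal (real L * (real r0 + 1 / (1 - q)))"
    using q by (simp add: ennreal_mult ennreal_of_nat_eq_real_of_nat flip: ennreal_plus)
  finally show ?thesis .
qed

context quasi_bernoulli_shift
begin

text \<open>A version of Matthews' bound: the expected time to visit all sets of a family exceeds the worst
  expected hitting time, here of order \<open>1 / m\<close>, by a factor of at most the order of the logarithm of the size of the
  family.\<close>

theorem expected_time_to_visit_all_le: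
  "\<exists>C>0. \<forall>n \<A> m (\<tau> :: (nat \<Rightarrow> nat) \<Rightarrow> ennreal).
     finite \<A> \<longrightarrow> \<A> \<noteq> {} \<longrightarrow> 0 < m \<longrightarrow>
     (\<forall>A\<in>\<A>. determined n A \<and> (\<forall>i<n. misses_letter i A) \<and> m \<le> prob A) \<longrightarrow>
     (\<forall>x\<in>full_shift. \<forall>t\<ge>1. (\<forall>A\<in>\<A>. \<exists>k<t. (shift ^^ k) x \<in> A) \<longrightarrow> \<tau> x \<le> of_nat t) \<longrightarrow>
     (\<integral>\<^sup>+x. \<tau> x \<partial>M) \<le> ennreal (C / m * (ln (real (card \<A>)) + 1))"
proof -
  define \<rho> where "\<rho> = decay_rate"
  have rho: "0 < \<rho>" "\<rho> < 1" using decay_rate by (auto simp: \<rho>_def)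
  define c where "c = 1 / spread / Q"
  have c0: "0 < c" using spread_pos Q_gt_1 by (simp add: c_def)
  define C where "C = 2 / (1 - \<rho>) * (2 + 1 / c)"
  have C0: "0 < C" unfolding C_def using rho c0 by (intro mult_pos_pos add_pos_pos) auto
  have bound: "(\<integral>\<^sup>+x. \<tau> x \<partial>M) \<le> ennreal (C / m * (ln (real (card \<A>)) + 1))"
    if fin: "finite \<A>" "\<A> \<noteq> {}" and m: "0 < m"
      and det: "\<And>A. A \<in> \<A> \<Longrightarrow> determined n A"
      and miss: "\<And>A i. A \<in> \<A> \<Longrightarrow> i < n \<Longrightarrow> misses_letter i A"
      and mA: "\<And>A. A \<in> \<A> \<Longrightarrow> m \<le> prob A"
      and \<tau>: "\<And>x t. x \<in> full_shift \<Longrightarrow> 1 \<le> t \<Longrightarrow> (\<forall>A\<in>\<A>. \<exists>k<t. (shift ^^ k) x \<in> A)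
          \<Longrightarrow> \<tau> x \<le> of_nat t"
    for n :: nat and \<A> m and \<tau> :: "(nat \<Rightarrow> nat) \<Rightarrow> ennreal"
  proof -
    obtain A0 where A0: "A0 \<in> \<A>" using fin by blast
    have m1: "m \<le> 1" using mA[OF A0] prob_le_1[of A0] by linarith
    define T where "T = nat \<lceil>1 / m\<rceil>"
    have T: "1 / m \<le> real T" "real T \<le> 2 / m"
    proof -
      have ge: "1 \<le> 1 / m" using m m1 by simp
      show "1 / m \<le> real T" unfolding T_def by (rule real_nat_ceiling_ge)
      have "real T \<le> 1 / m + 1" unfolding T_def using ge by linarith
      also have "\<dots> \<le> 2 / m" using ge by simp
      finally show "real T \<le> 2 / m" .
    qed
    have "0 < 1 / m" using m by simp
    then have "0 < T" using T(1) by (cases T) auto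
    define L where "L = T + n"
    \<comment> \<open>The extra \<open>n\<close> letters in a block are negligible: \<open>prob A\<close> decays exponentially in \<open>n\<close>, hence \<open>n\<close> is at most of order \<open>1 / m\<close>.\<close>
    have "real L \<le> 2 / m / (1 - \<rho>)"
    proof -
      have "1 + real n * (1 / \<rho> - 1) \<le> (1 + (1 / \<rho> - 1)) ^ n"
        using rho by (intro Bernoulli_inequality) simp
      also have "\<dots> = 1 / \<rho> ^ n" by (simp add: power_one_over)
      also have "\<dots> \<le> 1 / m"
        using order_trans[OF mA[OF A0] prob_misses_letter_le[OF det[OF A0] miss[OF A0]]] m
        by (intro divide_left_mono) (auto simp: \<rho>_def)
      also have "\<dots> \<le> real T" by (rule T)
      finally have "1 + real n * (1 / \<rho> - 1) \<le> real T" .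
      then have "\<rho> * (real n * (1 / \<rho> - 1)) \<le> \<rho> * real T" using rho by (intro mult_left_mono) auto
      then have "real n * (1 - \<rho>) \<le> \<rho> * real T" using rho by (simp add: algebra_simps)
      then have "real L * (1 - \<rho>) \<le> real T" by (simp add: L_def algebra_simps)
      also have "\<dots> \<le> 2 / m" by (rule T)
      finally show ?thesis using rho by (subst pos_le_divide_eq) simp_all
    qed
    define H where "H A = (\<Union>k<T. after k A)" for A
    define U where "U r = (\<Union>A\<in>\<A>. never_in (H A) L r)" for r
    have H: "determined L (H A)" if "A \<in> \<A>" for A
      unfolding H_def L_def
      by (intro determined_UN determined_mono[OF determined_after[OF det[OF that]]]) auto
    have sets: "never_in (H A) L r \<in> sets M" if "A \<in> \<A>" for A r
      by (rule determined_sets_M[OF determined_never_in[OF H[OF that]]])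
    have hit: "1 / spread \<le> prob (H A)" if "A \<in> \<A>" for A
      unfolding H_def
    proof (rule prob_visit_ge[OF det miss])
      have "1 = 1 / m * m" using m by simp
      also have "\<dots> \<le> real T * prob A" using T mA[OF that] m by (intro mult_mono) auto
      finally show "1 \<le> real T * prob A" .
    qed (use that in auto)
    have "1 / spread \<le> 1" using order_trans[OF hit[OF A0] prob_le_1] .
    then have "1 / spread < Q" using Q_gt_1 by linarith
    then have c1: "c < 1" unfolding c_def using Q_gt_1 by (subst pos_divide_less_eq) auto
    define N where "N = real (card \<A>)"
    have "0 < card \<A>" using fin by (simp add: card_gt_0_iff)
    then have N1: "1 \<le> N" unfolding N_def by linarith
    define r0 where "r0 = nat \<lceil>ln N / c\<rceil> + 1"
    have r0: "ln N / c \<le> real r0" "real r0 \<le> ln N / c + 2"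
    proof -
      have "0 \<le> ln N / c" using N1 c0 by simp
      then show "ln N / c \<le> real r0" "real r0 \<le> ln N / c + 2" unfolding r0_def by linarith+
    qed
    have "(\<integral>\<^sup>+x. \<tau> x \<partial>M) \<le> ennreal (real L * (real r0 + 1 / (1 - (1 - c))))"
    proof (rule nn_integral_time_le)
      show "U r \<in> events" for r unfolding U_def using fin sets by auto
      show "prob (U r) \<le> N * (1 - c) ^ r" for r
      proof -
        have "prob (U r) \<le> (\<Sum>A\<in>\<A>. prob (never_in (H A) L r))"
          unfolding U_def using fin sets by (intro finite_measure_subadditive_finite) auto
        also have "\<dots> \<le> (\<Sum>A\<in>\<A>. (1 - c) ^ r)"
          unfolding c_def by (intro sum_mono prob_never_in_le H hit)
        finally show ?thesis by (simp add: N_def)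
      qed
      show "0 \<le> 1 - c" "1 - c < 1" "0 \<le> N" "1 \<le> r0" using c0 c1 N1 by (auto simp: r0_def)
      show "N * (1 - c) ^ r0 \<le> 1"
      proof -
        have "(1 - c) ^ r0 \<le> exp (- c) ^ r0"
          using exp_ge_add_one_self[of "- c"] c1 by (intro power_mono) auto
        also have "\<dots> = exp (- (c * real r0))" by (simp add: exp_of_nat_mult[symmetric] mult.commute)
        also have "\<dots> \<le> exp (- ln N)" using r0(1) c0 by (simp add: field_simps)
        also have "\<dots> = 1 / N" using N1 by (simp add: exp_minus inverse_eq_divide)
        finally show ?thesis using N1 by (simp add: field_simps)
      qed
      show "0 < L" using \<open>0 < T\<close> by (simp add: L_def)
      fix x r assume x: "x \<in> space M" "1 \<le> (r::nat)" "x \<notin> U r"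
      show "\<tau> x \<le> of_nat (r * L)"
      proof (rule \<tau>)
        show "x \<in> full_shift" using x by (simp add: space_M)
        show "1 \<le> r * L" using x \<open>0 < T\<close> by (simp add: L_def)
        show "\<forall>A\<in>\<A>. \<exists>k<r * L. (shift ^^ k) x \<in> A"
        proof
          fix A assume "A \<in> \<A>"
          then obtain i where i: "i < r" "(shift ^^ (i * L)) x \<in> H A"
            using x by (auto simp: U_def never_in_def space_M)
          then obtain k where k: "k < T" "(shift ^^ k) ((shift ^^ (i * L)) x) \<in> A"
            by (auto simp: H_def after_def)
          have "k + i * L < Suc i * L" using k by (simp add: L_def)
          also have "\<dots> \<le> r * L" using i by (intro mult_right_mono) auto
          finally show "\<exists>k<r * L. (shift ^^ k) x \<in> A"
            using k(2) unfolding funpow_shift_add by blast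
        qed
      qed
    qed
    also have "\<dots> \<le> ennreal (C / m * (ln N + 1))"
    proof (rule ennreal_leI)
      have lN: "0 \<le> ln N" using N1 by simp
      have "real L * (real r0 + 1 / (1 - (1 - c)))
          \<le> 2 / m / (1 - \<rho>) * ((2 + 1 / c) * (ln N + 1))"
      proof (rule mult_mono)
        show "real r0 + 1 / (1 - (1 - c)) \<le> (2 + 1 / c) * (ln N + 1)"
          using r0(2) lN by (simp add: algebra_simps)
      qed (use \<open>real L \<le> 2 / m / (1 - \<rho>)\<close> m rho c0 in auto)
      also have "\<dots> = C / m * (ln N + 1)" 
        unfolding C_def by (simp only: divide_inverse mult_ac)
      finally show "real L * (real r0 + 1 / (1 - (1 - c))) \<le> C / m * (ln N + 1)" .
    qed
    finally show ?thesis by (simp add: N_def)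
  qed
  show ?thesis
    by (intro exI[of _ C] conjI C0 allI impI, rule bound) auto
qed

end


section \<open>Gibbs measures are quasi-Bernoulli\<close>

lemma birkhoff_sum_add:
  "birkhoff_sum \<phi> (n + m) x = birkhoff_sum \<phi> n x + birkhoff_sum \<phi> m ((shift ^^ n) x)"
  by (induction m) (auto simp: birkhoff_sum_def funpow_shift_add add.commute simp del: funpow.simps)

lemma cylinder_nonempty:
  assumes "set u \<subseteq> {1..}" obtains x where "x \<in> cylinder u"
proof
  have "1 \<le> u ! i" if "i < length u" for i
    using assms nth_mem[OF that] by auto
  then show "(\<lambda>i. if i < length u then u ! i else 1) \<in> cylinder u"
    by (simp add: cylinder_def full_shift_def)
qed

text \<open>Birkhoff sums are additive along concatenations, and up to the Gibbs constant \<open>K\<close> the measure of a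
  cylinder is a function of the Birkhoff sum at any one of its points.  One comparison for each of the
  three words \<open>u\<close>, \<open>v\<close>, \<open>u @ v\<close> gives \<open>Q = K ^ 3\<close>.\<close>

lemma gibbs_measure_imp_quasi_bernoulli:
  assumes "gibbs_measure \<phi> \<mu>" obtains Q where "quasi_bernoulli_shift \<mu> Q"
proof -
  interpret prob_space \<mu> using assms by (simp add: gibbs_measure_def)
  have sets: "sets \<mu> = sets shift_space" and inv: "distr \<mu> \<mu> shift = \<mu>"
    using assms by (auto simp: gibbs_measure_def)
  have "space \<mu> = full_shift"
    using sets_eq_imp_space_eq[OF sets] by (simp add: space_shift_space)
  then have full: "prob full_shift = 1" using prob_space by simp
  obtain K P where K: "1 < K"
    and gibbs: "\<And>ys x. ys \<noteq> [] \<Longrightarrow> set ys \<subseteq> {1..} \<Longrightarrow> x \<in> cylinder ys \<Longrightarrow>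
      1 / K \<le> prob (cylinder ys) / exp (birkhoff_sum \<phi> (length ys) x - real (length ys) * P) \<and>
      prob (cylinder ys) / exp (birkhoff_sum \<phi> (length ys) x - real (length ys) * P) \<le> K"
    using assms unfolding gibbs_measure_def by blast
  define e where "e ys x = exp (birkhoff_sum \<phi> (length ys) x - real (length ys) * P)"
    for ys :: "nat list" and x
  have e0: "0 < e ys x" for ys x by (simp add: e_def)
  have up: "prob (cylinder ys) \<le> K * e ys x" and lo: "e ys x \<le> K * prob (cylinder ys)"
    if "ys \<noteq> []" "set ys \<subseteq> {1..}" "x \<in> cylinder ys" for ys x
  proof -
    have *: "1 / K \<le> prob (cylinder ys) / e ys x" "prob (cylinder ys) / e ys x \<le> K"
      using gibbs[OF that] by (auto simp: e_def)
    show "prob (cylinder ys) \<le> K * e ys x" using *(2) e0[of ys x] by (simp add: pos_divide_le_eq)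
    show "e ys x \<le> K * prob (cylinder ys)"
      using *(1) K e0[of ys x] by (simp add: field_simps)
  qed
  have pos: "0 < prob (cylinder u)" if u: "set u \<subseteq> {1..}" for u
  proof (cases "u = []")
    case True
    then show ?thesis by (simp add: full)
  next
    case False
    obtain x where "x \<in> cylinder u" using cylinder_nonempty[OF u] .
    then have "0 < K * prob (cylinder u)" using lo[OF False u] e0[of u x] by fastforce
    then show ?thesis using K by (simp add: zero_less_mult_iff)
  qed
  have K3: "1 < K ^ 3" using K by (simp add: one_less_power)
  have quasi: "prob (cylinder (u @ v)) \<le> K ^ 3 * prob (cylinder u) * prob (cylinder v) \<and>
      prob (cylinder u) * prob (cylinder v) \<le> K ^ 3 * prob (cylinder (u @ v))"
    if u: "set u \<subseteq> {1..}" and v: "set v \<subseteq> {1..}" for u v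
  proof (cases "u = [] \<or> v = []")
    case True
    have "p \<le> K ^ 3 * p" if "0 \<le> p" for p :: real
      using mult_right_mono[OF less_imp_le[OF K3] that] by simp
    with True show ?thesis by (auto simp: full)
  next
    case False
    then have ne: "u \<noteq> []" "v \<noteq> []" "u @ v \<noteq> []" by auto
    have uv: "set (u @ v) \<subseteq> {1..}" using u v by simp
    obtain x where x: "x \<in> cylinder (u @ v)" using cylinder_nonempty[OF uv] .
    then have xu: "x \<in> cylinder u" and xv: "(shift ^^ length u) x \<in> cylinder v"
      by (auto simp: cylinder_append after_def)
    have e: "e (u @ v) x = e u x * e v ((shift ^^ length u) x)"
      by (simp add: e_def birkhoff_sum_add exp_add[symmetric] algebra_simps)
    have "prob (cylinder (u @ v)) \<le> K * (e u x * e v ((shift ^^ length u) x))"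
      using up[OF ne(3) uv x] by (simp add: e)
    also have "\<dots> \<le> K * ((K * prob (cylinder u)) * (K * prob (cylinder v)))"
      using K e0 by (intro mult_left_mono mult_mono lo ne u v xu xv) (auto intro: less_imp_le)
    finally have 1: "prob (cylinder (u @ v)) \<le> K ^ 3 * prob (cylinder u) * prob (cylinder v)"
      by (simp add: power3_eq_cube algebra_simps)
    have "prob (cylinder u) * prob (cylinder v)
        \<le> (K * e u x) * (K * e v ((shift ^^ length u) x))"
      using K e0 by (intro mult_mono up ne u v xu xv) (auto intro: less_imp_le)
    also have "\<dots> = K * K * e (u @ v) x" by (simp add: e)
    also have "\<dots> \<le> K * K * (K * prob (cylinder (u @ v)))"
      using K by (intro mult_left_mono lo[OF ne(3) uv x]) auto
    finally show ?thesis using 1 by (simp add: power3_eq_cube algebra_simps)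
  qed
  have "quasi_bernoulli_shift \<mu> (K ^ 3)"
    by unfold_locales (use sets inv K3 pos quasi in auto)
  with that show thesis .
qed

section \<open>Small balls of the metric\<close>

definition letter_weight :: "real \<Rightarrow> nat \<Rightarrow> real" where
  "letter_weight \<alpha> k = 1 / exp (\<alpha> * real k)"

locale weighted_shift =
  fixes \<theta> \<alpha> :: real
  assumes theta: "0 < \<theta>" "\<theta> < 1" and alpha: "0 < \<alpha>"
begin

abbreviation w :: "nat \<Rightarrow> real" where "w \<equiv> letter_weight \<alpha>"

definition prefix_dist :: "nat \<Rightarrow> (nat \<Rightarrow> nat) \<Rightarrow> (nat \<Rightarrow> nat) \<Rightarrow> real" where
  "prefix_dist n x y = (\<Sum>i<n. \<theta> ^ i * \<bar>w (x i) - w (y i)\<bar>)"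

text \<open>Reducing large letters to \<open>J\<close> moves a point only slightly, since all letters from \<open>J\<close> on have small
  weight.  Letters from position \<open>n\<close> on contribute little to the metric and are set to \<open>1\<close>.\<close>

definition truncate :: "nat \<Rightarrow> nat \<Rightarrow> (nat \<Rightarrow> nat) \<Rightarrow> nat \<Rightarrow> nat" where
  "truncate J n x = (\<lambda>i. if i < n then min (x i) J else 1)"

sublocale metric: Metric_space full_shift "d2 \<theta> \<alpha>"
  by (rule Metric_space_d2[OF theta alpha])

lemma w_bounds: "0 < w k" "w k \<le> 1"
  using alpha by (auto simp: letter_weight_def)

lemma w_strict_antimono: "j < k \<Longrightarrow> w k < w j"
  using alpha by (auto simp: letter_weight_def intro!: divide_strict_left_mono)

lemma w_diff_le: "\<bar>w j - w k\<bar> \<le> 1"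
  using w_bounds[of j] w_bounds[of k] by linarith

lemma summable_d2_w: "summable (\<lambda>i. \<theta> ^ i * \<bar>w (x i) - w (y i)\<bar>)"
  using summable_d2[OF theta alpha] by (simp add: letter_weight_def)

lemma d2_w: "d2 \<theta> \<alpha> x y = (\<Sum>i. \<theta> ^ i * \<bar>w (x i) - w (y i)\<bar>)"
  by (simp add: d2_def letter_weight_def)

lemma prefix_dist_le_d2: "prefix_dist n x y \<le> d2 \<theta> \<alpha> x y"
  unfolding d2_w prefix_dist_def
  using theta by (intro sum_le_suminf summable_d2_w) auto

lemma d2_le_prefix_dist: "d2 \<theta> \<alpha> x y \<le> prefix_dist n x y + \<theta> ^ n / (1 - \<theta>)"
proof -
  let ?f = "\<lambda>i. \<theta> ^ i * \<bar>w (x i) - w (y i)\<bar>"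
  have "d2 \<theta> \<alpha> x y = (\<Sum>i. ?f (i + n)) + prefix_dist n x y"
    unfolding d2_w prefix_dist_def by (rule suminf_split_initial_segment[OF summable_d2_w])
  also have "(\<Sum>i. ?f (i + n)) \<le> (\<Sum>i. \<theta> ^ n * \<theta> ^ i)"
  proof (rule suminf_le)
    show "?f (i + n) \<le> \<theta> ^ n * \<theta> ^ i" for i
      using mult_left_mono[OF w_diff_le[of "x (i+n)" "y (i+n)"], of "\<theta> ^ (i+n)"] theta
      by (simp add: power_add mult.commute)
    show "summable (\<lambda>i. ?f (i + n))" by (rule summable_ignore_initial_segment[OF summable_d2_w])
    show "summable (\<lambda>i. \<theta> ^ n * \<theta> ^ i)"
      using theta by (intro summable_mult) (simp add: summable_geometric)
  qed
  also have "\<dots> = \<theta> ^ n / (1 - \<theta>)"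
    using suminf_mult[OF summable_geometric[of \<theta>], of "\<theta> ^ n"] suminf_geometric[of \<theta>] theta by simp
  finally show ?thesis by simp
qed

lemma prefix_dist_triangle: "prefix_dist n x z \<le> prefix_dist n x y + prefix_dist n y z"
  unfolding prefix_dist_def sum.distrib[symmetric] distrib_left[symmetric]
  using theta by (intro sum_mono mult_left_mono) auto

lemma prefix_dist_commute: "prefix_dist n x y = prefix_dist n y x"
  by (simp add: prefix_dist_def abs_minus_commute)

lemma prefix_dist_truncate_le: "prefix_dist n x (truncate J n x) \<le> w J / (1 - \<theta>)"
proof -
  have "prefix_dist n x (truncate J n x) \<le> (\<Sum>i<n. \<theta> ^ i * w J)"
    unfolding prefix_dist_def
  proof (intro sum_mono mult_left_mono)
    fix i assume "i \<in> {..<n}"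
    then have *: "truncate J n x i = min (x i) J" by (simp add: truncate_def)
    show "\<bar>w (x i) - w (truncate J n x i)\<bar> \<le> w J"
    proof (cases "x i \<le> J")
      case True
      then show ?thesis using * w_bounds[of J] by simp
    next
      case False
      then show ?thesis using * w_bounds[of "x i"] w_strict_antimono[of J "x i"] by simp
    qed
  qed (use theta in auto)
  also have "\<dots> = (\<Sum>i<n. \<theta> ^ i) * w J" by (simp add: sum_distrib_right)
  also have "\<dots> \<le> 1 / (1 - \<theta>) * w J"
    using theta w_bounds[of J] by (intro mult_right_mono) (auto simp: sum_gp_strict field_simps)
  finally show ?thesis by simp
qed

lemma truncate_full_shift: "x \<in> full_shift \<Longrightarrow> 1 \<le> J \<Longrightarrow> truncate J n x \<in> full_shift"
  by (simp add: full_shift_def truncate_def)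

definition centers :: "nat \<Rightarrow> nat \<Rightarrow> (nat \<Rightarrow> nat) set" where
  "centers J n = truncate J n ` full_shift"

lemma centers_full_shift: "1 \<le> J \<Longrightarrow> centers J n \<subseteq> full_shift"
  by (auto simp: centers_def truncate_full_shift)

lemma centers_card:
  assumes "1 \<le> J" shows "finite (centers J n)" "card (centers J n) \<le> J ^ n" "centers J n \<noteq> {}"
proof -
  let ?P = "{..<n} \<rightarrow>\<^sub>E {1..J}"
  have sub: "centers J n \<subseteq> (\<lambda>f i. if i < n then f i else 1) ` ?P"
  proof
    fix z assume "z \<in> centers J n"
    then obtain x where x: "x \<in> full_shift" "z = truncate J n x" by (auto simp: centers_def)
    have "z = (\<lambda>i. if i < n then restrict z {..<n} i else 1)"
      by (auto simp: x(2) truncate_def)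
    moreover have "restrict z {..<n} \<in> ?P"
      using x assms by (auto simp: truncate_def full_shift_def)
    ultimately show "z \<in> (\<lambda>f i. if i < n then f i else 1) ` ?P" by (rule image_eqI)
  qed
  have fin: "finite ?P" by (intro finite_PiE) auto
  show "finite (centers J n)" using finite_subset[OF sub] fin by simp
  have "card (centers J n) \<le> card ?P"
    by (rule order_trans[OF card_mono[OF finite_imageI[OF fin] sub] card_image_le[OF fin]])
  then show "card (centers J n) \<le> J ^ n" by (simp add: card_PiE)
  have "(\<lambda>_. 1) \<in> full_shift" by (simp add: full_shift_def)
  then show "centers J n \<noteq> {}" by (auto simp: centers_def)
qed

text \<open>Such sets are determined by \<open>n\<close> letters and lie between the balls of radius \<open>s\<close> and
  \<open>s + \<theta> ^ n / (1 - \<theta>)\<close>.  Near points with large letters, a product of sets of letters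
  would be too small: to have diameter at most \<open>\<delta>\<close> its sides in about \<open>log (1 / \<delta>)\<close> coordinates have to add up to at most \<open>\<delta>\<close>, so that it
  contains no ball of radius comparable to \<open>\<delta>\<close>.\<close>

definition prefix_ball :: "nat \<Rightarrow> real \<Rightarrow> (nat \<Rightarrow> nat) \<Rightarrow> (nat \<Rightarrow> nat) set" where
  "prefix_ball n s x = {y \<in> full_shift. prefix_dist n x y < s}"

lemma determined_prefix_ball: "determined n (prefix_ball n s x)"
  unfolding determined_def prefix_ball_def prefix_dist_def by auto

lemma mball_subset_prefix_ball: "metric.mball x s \<subseteq> prefix_ball n s x"
  unfolding prefix_ball_def by (auto intro: le_less_trans[OF prefix_dist_le_d2])

text \<open>Two points of the set that carry the letters \<open>1\<close> and \<open>2\<close> at position \<open>i\<close> would be too far apart.\<close>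

lemma prefix_ball_misses_letter:
  assumes "i < n" "2 * s \<le> \<theta> ^ i * (w 1 - w 2)"
  shows "misses_letter i (prefix_ball n s x)"
proof (rule ccontr)
  assume "\<not> misses_letter i (prefix_ball n s x)"
  then obtain y z where yz: "y \<in> prefix_ball n s x" "z \<in> prefix_ball n s x" "y i = 1" "z i = 2"
    by (auto simp: misses_letter_def)
  have "\<theta> ^ i * (w 1 - w 2) \<le> \<theta> ^ i * \<bar>w (y i) - w (z i)\<bar>"
    using theta yz by (intro mult_left_mono) auto
  also have "\<dots> \<le> prefix_dist n y z"
    unfolding prefix_dist_def using theta assms(1)
    by (intro member_le_sum[where f = "\<lambda>i. \<theta> ^ i * \<bar>w (y i) - w (z i)\<bar>"]) auto
  also have "\<dots> \<le> prefix_dist n x y + prefix_dist n x z"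
    using prefix_dist_triangle[of n y z x] prefix_dist_commute[of n x y] by simp
  also have "\<dots> < 2 * s" using yz by (simp add: prefix_ball_def)
  finally show False using assms(2) by simp
qed

text \<open>The budget \<open>\<delta>\<close> is split into \<open>\<delta> / 2\<close> for the letters from position \<open>n\<close> on, \<open>\<delta> / 4\<close> for truncating
  the target point and \<open>\<delta> / 4\<close> for the radius of the prefix balls.\<close>

lemma delta_dense_if_hits_prefix_balls:
  assumes tail: "\<theta> ^ n / (1 - \<theta>) \<le> \<delta> / 2" and J: "w J / (1 - \<theta>) \<le> \<delta> / 4" and s: "s \<le> \<delta> / 4"
    and hit: "\<And>x. x \<in> centers J n \<Longrightarrow> \<exists>a\<in>A. a \<in> prefix_ball n s x"
  shows "delta_dense \<theta> \<alpha> \<delta> A"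
  unfolding delta_dense_def
proof
  fix b assume "b \<in> full_shift"
  then obtain a where a: "a \<in> A" "prefix_dist n (truncate J n b) a < s"
    using hit[of "truncate J n b"] by (auto simp: centers_def prefix_ball_def)
  have "d2 \<theta> \<alpha> a b \<le> prefix_dist n a b + \<theta> ^ n / (1 - \<theta>)" by (rule d2_le_prefix_dist)
  moreover have "prefix_dist n a b \<le> prefix_dist n a (truncate J n b) + prefix_dist n (truncate J n b) b"
    by (rule prefix_dist_triangle)
  ultimately have "d2 \<theta> \<alpha> a b \<le> \<delta>"
    using a(2) tail J s prefix_dist_truncate_le[of n b J]
    unfolding prefix_dist_commute[of n a] prefix_dist_commute[of n _ b] by linarith
  then show "\<exists>a\<in>A. d2 \<theta> \<alpha> a b \<le> \<delta>" using a(1) by blast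
qed

lemma ex_fine_prefix:
  assumes "0 < r" obtains n where "\<theta> ^ n / (1 - \<theta>) < r"
proof -
  have "\<exists>n. \<theta> ^ n < r * (1 - \<theta>)"
    using theta assms by (intro real_arch_pow_inv) auto
  then show thesis using that theta by (auto simp: pos_divide_less_eq)
qed

lemma ex_small_weight:
  assumes "0 < r" obtains J where "1 \<le> J" "w J < r"
proof -
  obtain J :: nat where J: "1 / (r * \<alpha>) < real J" using reals_Archimedean2 by blast
  have "0 < 1 / (r * \<alpha>)" using assms alpha by simp
  then have "1 \<le> J" using J by (cases J) auto
  have "1 / r < \<alpha> * real J" using J assms alpha by (simp add: field_simps)
  also have "\<dots> < exp (\<alpha> * real J)" using exp_ge_add_one_self[of "\<alpha> * real J"] by linarith
  finally have "w J < r" using assms by (simp add: letter_weight_def field_simps)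
  with \<open>1 \<le> J\<close> that show thesis by blast
qed

text \<open>Both \<open>n\<close> and \<open>J\<close> can be taken of order \<open>log (1 / \<delta>)\<close>, so the logarithm \<open>n log J\<close> of the number of
  centers has order \<open>log (1 / \<delta>) log log (1 / \<delta>)\<close>.  As \<open>\<delta>\<close> stays below \<open>\<delta>\<^sub>0 < 1 / e\<close>, the double
  logarithm is bounded below by \<open>g > 0\<close> and absorbs all additive constants.  Choosing \<open>n\<close> minimal keeps
  \<open>\<theta> ^ i\<close> above a multiple of \<open>\<delta>\<close> for \<open>i < n\<close>, as needed for prefix balls of radius proportional
  to \<open>\<delta>\<close> to miss a letter in each of these coordinates.\<close>

lemma ex_cover_parameters:
  assumes \<delta>0: "0 < \<delta>\<^sub>0" "\<delta>\<^sub>0 < exp (- 1)"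
  obtains C where "0 < C" "\<And>\<delta>. 0 < \<delta> \<Longrightarrow> \<delta> \<le> \<delta>\<^sub>0 \<Longrightarrow> \<exists>n J. 1 \<le> J \<and> \<theta> ^ n / (1 - \<theta>) \<le> \<delta> / 2 \<and>
    w J / (1 - \<theta>) \<le> \<delta> / 4 \<and> (\<forall>i<n. \<delta> * (1 - \<theta>) / 2 \<le> \<theta> ^ i) \<and>
    real n * ln (real J) + 1 \<le> C * ln (1 / \<delta>) * ln (ln (1 / \<delta>))"
proof -
  define t where "t = ln (1 / \<theta>)"
  define d where "d = ln (2 / (1 - \<theta>))"
  define e where "e = ln (4 / (1 - \<theta>))"
  define g where "g = ln (ln (1 / \<delta>\<^sub>0))"
  define b where "b = (1 + d) / t + 1"
  define a where "a = (1 + e) / \<alpha> + 1"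
  have t: "0 < t" using theta by (simp add: t_def)
  have d: "0 < d" "0 < e" using theta by (auto simp: d_def e_def)
  have "1 < ln (1 / \<delta>\<^sub>0)" using \<delta>0 ln_less_cancel_iff[of \<delta>\<^sub>0 "exp (-1)"] by (simp add: ln_div)
  then have g: "0 < g" by (simp add: g_def)
  have b: "0 < b" using t d by (simp add: b_def add_pos_pos)
  have a: "1 \<le> a" using alpha d by (simp add: a_def)
  define C where "C = b * (ln a / g + 1) + 1 / g"
  have "0 < C" unfolding C_def using a b g by (intro add_nonneg_pos mult_nonneg_nonneg) auto
  moreover have "\<exists>n J. 1 \<le> J \<and> \<theta> ^ n / (1 - \<theta>) \<le> \<delta> / 2 \<and>
      w J / (1 - \<theta>) \<le> \<delta> / 4 \<and> (\<forall>i<n. \<delta> * (1 - \<theta>) / 2 \<le> \<theta> ^ i) \<and>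
      real n * ln (real J) + 1 \<le> C * ln (1 / \<delta>) * ln (ln (1 / \<delta>))"
    if \<delta>: "0 < \<delta>" "\<delta> \<le> \<delta>\<^sub>0" for \<delta>
  proof -
    define l where "l = ln (1 / \<delta>)"
    have l: "ln (1 / \<delta>\<^sub>0) \<le> l" unfolding l_def using \<delta> \<delta>0 by (simp add: ln_div)
    have l1: "1 < l" using l \<open>1 < ln (1 / \<delta>\<^sub>0)\<close> by linarith
    have gl: "g \<le> ln l" unfolding g_def using l \<open>1 < ln (1 / \<delta>\<^sub>0)\<close> by simp
    define \<eta> where "\<eta> = \<delta> * (1 - \<theta>) / 2"
    have \<eta>: "0 < \<eta>" "ln (1 / \<eta>) = l + d"
      using \<delta> theta by (auto simp: \<eta>_def l_def d_def ln_div ln_mult)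
    have ex: "\<exists>n. \<theta> ^ n \<le> \<eta>" using real_arch_pow_inv[OF \<eta>(1) theta(2)] by (auto intro: less_imp_le)
    define n where "n = (LEAST n. \<theta> ^ n \<le> \<eta>)"
    have n: "\<theta> ^ n \<le> \<eta>" unfolding n_def by (rule LeastI_ex[OF ex])
    have n': "\<eta> < \<theta> ^ i" if "i < n" for i
      using not_less_Least[OF that[unfolded n_def]] by simp
    have nb: "real n \<le> b * l"
    proof (cases n)
      case 0
      then show ?thesis using b l1 by simp
    next
      case (Suc i)
      then have "ln \<eta> < ln (\<theta> ^ i)" using n'[of i] \<eta> theta by simp
      then have "real i * t < l + d" using \<eta> theta by (simp add: t_def ln_div ln_realpow)
      then have "real i < (l + d) / t" using t by (simp add: pos_less_divide_eq)
      also have "\<dots> \<le> (l + d * l) / t" using l1 d t by (intro divide_right_mono) auto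
      finally have "real n \<le> (l + d * l) / t + l" using l1 Suc by simp
      then show ?thesis by (simp add: b_def field_simps)
    qed
    define J where "J = nat \<lceil>(l + e) / \<alpha>\<rceil>"
    have J0: "0 < (l + e) / \<alpha>" using l1 d alpha by simp
    have J: "(l + e) / \<alpha> \<le> real J" "real J \<le> (l + e) / \<alpha> + 1"
      unfolding J_def using J0 by linarith+
    have J1: "1 \<le> J" using J0 J(1) by (cases J) auto
    have "real J \<le> (l + e * l) / \<alpha> + l"
    proof -
      have "(l + e) / \<alpha> \<le> (l + e * l) / \<alpha>" using l1 d alpha by (intro divide_right_mono) auto
      then show ?thesis using J(2) l1 by linarith
    qed
    then have Ja: "real J \<le> a * l" by (simp add: a_def field_simps)
    have "ln (real J) \<le> ln (a * l)" using Ja J1 by simp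
    also have "\<dots> = ln a + ln l" using a l1 by (simp add: ln_mult)
    also have "\<dots> \<le> (ln a / g + 1) * ln l"
    proof -
      have "ln a / g * g \<le> ln a / g * ln l" using gl a g by (intro mult_left_mono) auto
      then show ?thesis using g by (simp add: algebra_simps)
    qed
    finally have lJ: "ln (real J) \<le> (ln a / g + 1) * ln l" .
    have "real n * ln (real J) \<le> (b * l) * ((ln a / g + 1) * ln l)"
      using nb lJ b l1 J1 by (intro mult_mono) auto
    moreover have "1 \<le> 1 / g * (l * ln l)"
    proof -
      have "1 * g \<le> l * ln l" using l1 gl g by (intro mult_mono) auto
      then show ?thesis using g by (simp add: field_simps)
    qed
    ultimately have "real n * ln (real J) + 1 \<le> C * l * ln l"
      by (simp add: C_def algebra_simps)
    moreover have "\<theta> ^ n / (1 - \<theta>) \<le> \<delta> / 2"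
      using n theta by (simp add: \<eta>_def pos_divide_le_eq)
    moreover have "w J / (1 - \<theta>) \<le> \<delta> / 4"
    proof -
      have "l + e \<le> \<alpha> * real J" using J(1) alpha by (simp add: field_simps)
      then have "exp (l + e) \<le> exp (\<alpha> * real J)" by simp
      moreover have "exp (l + e) = 4 / (\<delta> * (1 - \<theta>))"
        using \<delta> theta by (simp add: l_def e_def exp_add)
      ultimately have "4 / (\<delta> * (1 - \<theta>)) \<le> exp (\<alpha> * real J)" by simp
      then show ?thesis using \<delta> theta by (simp add: letter_weight_def field_simps)
    qed
    moreover have "\<forall>i<n. \<delta> * (1 - \<theta>) / 2 \<le> \<theta> ^ i"
      using n' by (auto simp: \<eta>_def intro: less_imp_le)
    ultimately show ?thesis using J1 unfolding l_def by blast
  qed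
  ultimately show thesis by (rule that)
qed

end


section \<open>Covering times and ball measures\<close>

locale weighted_quasi_bernoulli_shift = quasi_bernoulli_shift M Q + weighted_shift \<theta> \<alpha>
  for M Q \<theta> \<alpha>
begin

lemma mball_sets: "metric.mball x r \<in> sets M"
  unfolding sets_M sets_shift_space_eq_borel[OF theta alpha]
  by (rule sigma_sets.Basic) simp

lemma cylinder_subset_mball:
  assumes x: "x \<in> full_shift" and y: "prefix_dist n x y + \<theta> ^ n / (1 - \<theta>) < r"
  shows "cylinder (map y [0..<n]) \<subseteq> metric.mball x r"
proof
  fix z assume z: "z \<in> cylinder (map y [0..<n])"
  then have "prefix_dist n x z = prefix_dist n x y"
    by (auto simp: prefix_dist_def cylinder_def intro!: sum.cong)
  then have "d2 \<theta> \<alpha> x z < r" using d2_le_prefix_dist[of x z n] y by simp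
  then show "z \<in> metric.mball x r" using x z by (simp add: cylinder_def)
qed

lemma set_prefix_subset: "x \<in> full_shift \<Longrightarrow> set (map x [0..<n]) \<subseteq> {1..}"
  by (auto simp: full_shift_def)

text \<open>Every nonempty open set contains a cylinder, and cylinders have positive measure.\<close>

lemma topological_support_eq: "topological_support metric.mtopology M = full_shift"
proof
  show "topological_support metric.mtopology M \<subseteq> full_shift"
    by (auto simp: topological_support_def)
  show "full_shift \<subseteq> topological_support metric.mtopology M"
  proof
    fix x assume x: "x \<in> full_shift"
    have "0 < emeasure M U" if U: "openin metric.mtopology U" "x \<in> U" for U
    proof -
      obtain r where r: "0 < r" "metric.mball x r \<subseteq> U"
        using U unfolding metric.openin_mtopology by blast
      obtain n where n: "\<theta> ^ n / (1 - \<theta>) < r" using ex_fine_prefix[OF r(1)] .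
      have "cylinder (map x [0..<n]) \<subseteq> U"
        using cylinder_subset_mball[OF x, of n x r] n r(2) by (auto simp: prefix_dist_def)
      moreover have "U \<in> sets M"
        unfolding sets_M sets_shift_space_eq_borel[OF theta alpha]
        by (rule sigma_sets.Basic) (simp add: U)
      ultimately have "emeasure M (cylinder (map x [0..<n])) \<le> emeasure M U"
        by (rule emeasure_mono)
      moreover have "0 < emeasure M (cylinder (map x [0..<n]))"
        using cylinder_pos[OF set_prefix_subset[OF x]] by (simp add: emeasure_eq_measure)
      ultimately show ?thesis by simp
    qed
    then show "x \<in> topological_support metric.mtopology M"
      using x by (simp add: topological_support_def)
  qed
qed

lemma min_ball_measure_eq:
  "min_ball_measure \<theta> \<alpha> M r = (INF x\<in>full_shift. prob (metric.mball x r))"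
  by (simp add: min_ball_measure_def topological_support_eq)

lemma full_shift_nonempty: "full_shift \<noteq> {}"
proof -
  have "(\<lambda>_. 1) \<in> full_shift" by (simp add: full_shift_def)
  then show ?thesis by blast
qed

lemma min_ball_measure_le:
  "x \<in> full_shift \<Longrightarrow> min_ball_measure \<theta> \<alpha> M r \<le> prob (metric.mball x r)"
  unfolding min_ball_measure_eq by (intro cINF_lower bdd_belowI2[of _ 0]) auto

text \<open>Despite the lack of compactness the infimum is positive: the metric is totally bounded, so every
  ball of radius \<open>r\<close> contains one of finitely many cylinders, namely one around a truncation of its
  center.\<close>

lemma min_ball_measure_pos:
  assumes "0 < r" shows "0 < min_ball_measure \<theta> \<alpha> M r"
proof -
  obtain n where n: "\<theta> ^ n / (1 - \<theta>) < r / 2" using ex_fine_prefix[of "r / 2"] assms by auto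
  have "0 < r / 2 * (1 - \<theta>)" using assms theta by simp
  then obtain J where J: "1 \<le> J" "w J < r / 2 * (1 - \<theta>)" by (rule ex_small_weight)
  then have J': "w J / (1 - \<theta>) < r / 2" using theta by (simp add: pos_divide_less_eq)
  define m where "m = Min ((\<lambda>y. prob (cylinder (map y [0..<n]))) ` centers J n)"
  note fin = centers_card[OF J(1), of n]
  have "0 < prob (cylinder (map y [0..<n]))" if "y \<in> centers J n" for y
    using that centers_full_shift[OF J(1)] by (intro cylinder_pos set_prefix_subset) auto
  then have "0 < m" unfolding m_def using fin by (subst Min_gr_iff) auto
  also have "m \<le> min_ball_measure \<theta> \<alpha> M r"
    unfolding min_ball_measure_eq
  proof (rule cINF_greatest[OF full_shift_nonempty])
    fix x assume x: "x \<in> full_shift"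
    let ?y = "truncate J n x"
    have "m \<le> prob (cylinder (map ?y [0..<n]))"
      unfolding m_def using fin x by (intro Min_le) (auto simp: centers_def)
    also have "\<dots> \<le> prob (metric.mball x r)"
    proof (rule finite_measure_mono[OF cylinder_subset_mball[OF x] mball_sets])
      show "prefix_dist n x ?y + \<theta> ^ n / (1 - \<theta>) < r"
        using prefix_dist_truncate_le[of n x J] J' n by linarith
    qed
    finally show "m \<le> prob (metric.mball x r)" .
  qed
  finally show ?thesis .
qed

lemma covering_time_le:
  assumes "delta_dense \<theta> \<alpha> \<delta> ((\<lambda>i. (shift ^^ i) x) ` {0..n})" "1 \<le> n"
  shows "ennreal_of_enat (covering_time \<theta> \<alpha> \<delta> x) \<le> of_nat n"
proof -
  have "covering_time \<theta> \<alpha> \<delta> x \<le> enat n"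
    unfolding covering_time_def using assms by (intro INF_lower) auto
  then have "ennreal_of_enat (covering_time \<theta> \<alpha> \<delta> x) \<le> ennreal_of_enat (enat n)"
    by (simp only: ennreal_of_enat_le_iff)
  then show ?thesis by simp
qed

lemma covering_time_ge:
  assumes "\<And>n. 1 \<le> n \<Longrightarrow> delta_dense \<theta> \<alpha> \<delta> ((\<lambda>i. (shift ^^ i) x) ` {0..n}) \<Longrightarrow> s \<le> n"
  shows "of_nat s \<le> ennreal_of_enat (covering_time \<theta> \<alpha> \<delta> x)"
proof -
  have "enat s \<le> covering_time \<theta> \<alpha> \<delta> x"
    unfolding covering_time_def using assms by (intro INF_greatest) auto
  then have "ennreal_of_enat (enat s) \<le> ennreal_of_enat (covering_time \<theta> \<alpha> \<delta> x)"
    by (simp only: ennreal_of_enat_le_iff)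
  then show ?thesis by simp
qed

text \<open>A \<open>\<delta>\<close>-dense orbit segment visits the ball.  By stationarity a segment of length \<open>s\<close> does so with
  probability at most \<open>s\<close> times the measure \<open>p\<close> of the ball, which is at most one half for
  \<open>s \<le> 1 / (2 * p)\<close>.  If \<open>p\<close> is large, the trivial bound \<open>\<tau> \<ge> 1\<close> is enough.\<close>

lemma expected_covering_time_ge:
  assumes x: "x \<in> full_shift" and r: "0 < r" "\<delta> < r"
  shows "ennreal (1 / (8 * prob (metric.mball x r))) \<le> expected_covering_time \<theta> \<alpha> M \<delta>"
proof -
  let ?B = "metric.mball x r"
  define p where "p = prob ?B"
  have avoid: "of_nat s * emeasure M (full_shift - (\<Union>k<s. after k ?B))
      \<le> expected_covering_time \<theta> \<alpha> M \<delta>" for s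
  proof -
    let ?A = "full_shift - (\<Union>k<s. after k ?B)"
    have A: "?A \<in> sets M"
      by (intro sets.Diff full_shift_sets sets.finite_UN after_sets_M mball_sets) auto
    have "of_nat s * emeasure M ?A = (\<integral>\<^sup>+y. of_nat s * indicator ?A y \<partial>M)"
      using A by (simp add: nn_integral_cmult)
    also have "\<dots> \<le> expected_covering_time \<theta> \<alpha> M \<delta>"
      unfolding expected_covering_time_def
    proof (rule nn_integral_mono)
      fix y
      show "of_nat s * indicator ?A y \<le> ennreal_of_enat (covering_time \<theta> \<alpha> \<delta> y)"
      proof (cases "y \<in> ?A")
        case True
        have "of_nat s \<le> ennreal_of_enat (covering_time \<theta> \<alpha> \<delta> y)"
        proof (rule covering_time_ge)
          fix n assume "delta_dense \<theta> \<alpha> \<delta> ((\<lambda>i. (shift ^^ i) y) ` {0..n})"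
          then obtain k where k: "k \<le> n" "d2 \<theta> \<alpha> ((shift ^^ k) y) x \<le> \<delta>"
            using x unfolding delta_dense_def by auto
          then have "y \<in> after k ?B"
            using True x r funpow_shift_full_shift[of y k]
            by (simp add: after_def metric.commute[of x])
          then show "s \<le> n" using True k(1) by (cases "k < s") auto
        qed
        then show ?thesis using True by simp
      qed simp
    qed
    finally show ?thesis .
  qed
  have p: "0 < p"
    using min_ball_measure_pos[of r] min_ball_measure_le[OF x, of r] r by (simp add: p_def)
  show ?thesis
  proof (cases "1 / 2 < p")
    case True
    have "ennreal (1 / (8 * p)) \<le> 1"
    proof -
      have "1 / (8 * p) \<le> 1" using True by (simp add: field_simps)
      then show ?thesis by (simp add: ennreal_le_1)
    qed
    also have "\<dots> = (\<integral>\<^sup>+y. of_nat 1 \<partial>M)" by (simp add: emeasure_space_1)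
    also have "\<dots> \<le> expected_covering_time \<theta> \<alpha> M \<delta>"
      unfolding expected_covering_time_def by (intro nn_integral_mono covering_time_ge)
    finally show ?thesis by (simp add: p_def)
  next
    case False
    define s where "s = nat \<lfloor>1 / (2 * p)\<rfloor>"
    have ge1: "1 \<le> 1 / (2 * p)" using False p by (simp add: field_simps)
    have s: "1 \<le> real s" "real s \<le> 1 / (2 * p)" "1 / (2 * p) < real s + 1"
    proof -
      have fl: "1 \<le> \<lfloor>1 / (2 * p)\<rfloor>" using ge1 by (simp only: one_le_floor)
      then have "real s = of_int \<lfloor>1 / (2 * p)\<rfloor>" unfolding s_def by (intro of_nat_nat) linarith
      moreover from this fl have "1 \<le> real s" by (simp only: of_int_1_le_iff)
      ultimately show "1 \<le> real s" "real s \<le> 1 / (2 * p)" "1 / (2 * p) < real s + 1"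
        using floor_correct[of "1 / (2 * p)"] by simp_all
    qed
    have "prob (\<Union>k<s. after k ?B) \<le> (\<Sum>k<s. prob (after k ?B))"
      by (intro finite_measure_subadditive_finite) (auto intro: after_sets_M mball_sets)
    also have "\<dots> = real s * p" by (simp add: prob_after[OF mball_sets] p_def)
    also have "\<dots> \<le> 1 / (2 * p) * p" using s p by (intro mult_right_mono) auto
    also have "\<dots> = 1 / 2" using p by simp
    finally have "prob (\<Union>k<s. after k ?B) \<le> 1 / 2" .
    moreover have "(\<Union>k<s. after k ?B) \<in> events"
      by (intro sets.finite_UN after_sets_M mball_sets) auto
    ultimately have "1 / 2 \<le> prob (full_shift - (\<Union>k<s. after k ?B))"
      using prob_compl[of "\<Union>k<s. after k ?B"] by (simp add: space_M)
    then have "real s * (1 / 2) \<le> real s * prob (full_shift - (\<Union>k<s. after k ?B))"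
      by (intro mult_left_mono) auto
    moreover have "1 / (8 * p) \<le> real s * (1 / 2)"
      using s by (simp add: field_simps)
    ultimately have "ennreal (1 / (8 * p))
        \<le> ennreal (real s * prob (full_shift - (\<Union>k<s. after k ?B)))"
      by (intro ennreal_leI) linarith
    also have "\<dots> = of_nat s * emeasure M (full_shift - (\<Union>k<s. after k ?B))"
      by (simp add: ennreal_mult emeasure_eq_measure ennreal_of_nat_eq_real_of_nat)
    also note avoid
    finally show ?thesis by (simp add: p_def)
  qed
qed

text \<open>The infimum need not be attained; a ball of measure less than twice the infimum will do.\<close>

lemma expected_covering_time_ge_min_ball:
  assumes "0 < \<delta>" "\<delta> < r"
  shows "ennreal (1 / 16 / min_ball_measure \<theta> \<alpha> M r) \<le> expected_covering_time \<theta> \<alpha> M \<delta>"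
proof -
  let ?m = "min_ball_measure \<theta> \<alpha> M r"
  have m: "0 < ?m" using assms by (intro min_ball_measure_pos) simp
  then have "(INF x\<in>full_shift. prob (metric.mball x r)) < 2 * ?m"
    by (simp add: min_ball_measure_eq)
  then obtain x where x: "x \<in> full_shift" "prob (metric.mball x r) < 2 * ?m"
    using full_shift_nonempty by (subst (asm) cINF_less_iff) (auto intro!: bdd_belowI2[of _ 0])
  have "0 < prob (metric.mball x r)" using m min_ball_measure_le[OF x(1), of r] by linarith
  then have "1 / 16 / ?m \<le> 1 / (8 * prob (metric.mball x r))"
    using x(2) m by (simp add: field_simps)
  then have "ennreal (1 / 16 / ?m) \<le> ennreal (1 / (8 * prob (metric.mball x r)))"
    by (rule ennreal_leI)
  also have "\<dots> \<le> expected_covering_time \<theta> \<alpha> M \<delta>"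
    using assms by (intro expected_covering_time_ge x(1)) auto
  finally show ?thesis .
qed

text \<open>The family of all prefix balls around the finitely many centers is visited.  Each of them contains
  an honest ball of radius \<open>s\<close>, hence has at least the minimal ball measure.\<close>

lemma expected_covering_time_le:
  "\<exists>C>0. \<forall>\<delta> s n J. 0 < s \<longrightarrow> s \<le> \<delta> / 4 \<longrightarrow> 1 \<le> J \<longrightarrow> \<theta> ^ n / (1 - \<theta>) \<le> \<delta> / 2 \<longrightarrow>
     w J / (1 - \<theta>) \<le> \<delta> / 4 \<longrightarrow> (\<forall>i<n. 2 * s \<le> \<theta> ^ i * (w 1 - w 2)) \<longrightarrow>
     expected_covering_time \<theta> \<alpha> M \<delta>
       \<le> ennreal (C / min_ball_measure \<theta> \<alpha> M s * (real n * ln (real J) + 1))"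
proof -
  obtain C where C: "0 < C" and bound: "\<And>n \<A> m (\<tau> :: (nat \<Rightarrow> nat) \<Rightarrow> ennreal).
     finite \<A> \<Longrightarrow> \<A> \<noteq> {} \<Longrightarrow> 0 < m \<Longrightarrow>
     (\<forall>A\<in>\<A>. determined n A \<and> (\<forall>i<n. misses_letter i A) \<and> m \<le> prob A) \<Longrightarrow>
     (\<forall>x\<in>full_shift. \<forall>t\<ge>1. (\<forall>A\<in>\<A>. \<exists>k<t. (shift ^^ k) x \<in> A) \<longrightarrow> \<tau> x \<le> of_nat t) \<Longrightarrow>
     (\<integral>\<^sup>+x. \<tau> x \<partial>M) \<le> ennreal (C / m * (ln (real (card \<A>)) + 1))"
    using expected_time_to_visit_all_le by blast
  show ?thesis
  proof (intro exI[of _ C] conjI C allI impI)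
    fix \<delta> s :: real and n J :: nat
    assume s: "0 < s" "s \<le> \<delta> / 4" and J: "1 \<le> J" and tail: "\<theta> ^ n / (1 - \<theta>) \<le> \<delta> / 2"
      and wJ: "w J / (1 - \<theta>) \<le> \<delta> / 4"
      and gap: "\<forall>i<n. 2 * s \<le> \<theta> ^ i * (w 1 - w 2)"
    let ?m = "min_ball_measure \<theta> \<alpha> M s"
    let ?A = "prefix_ball n s ` centers J n"
    note fin = centers_card[OF J, of n]
    have m: "0 < ?m" by (rule min_ball_measure_pos[OF s(1)])
    have "expected_covering_time \<theta> \<alpha> M \<delta> \<le> ennreal (C / ?m * (ln (real (card ?A)) + 1))"
      unfolding expected_covering_time_def
    proof (rule bound)
      show "finite ?A" "?A \<noteq> {}" "0 < ?m" using fin m by auto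
      show "\<forall>A\<in>?A. determined n A \<and> (\<forall>i<n. misses_letter i A) \<and> ?m \<le> prob A"
      proof (intro ballI conjI allI impI)
        fix A assume "A \<in> ?A"
        then obtain x where x: "x \<in> full_shift" "A = prefix_ball n s x"
          using centers_full_shift[OF J] by auto
        show "determined n A" by (simp add: x determined_prefix_ball)
        show "misses_letter i A" if "i < n" for i
          unfolding x by (rule prefix_ball_misses_letter[OF that gap[rule_format, OF that]])
        have "?m \<le> prob (metric.mball x s)" by (rule min_ball_measure_le[OF x(1)])
        also have "\<dots> \<le> prob A"
          unfolding x(2) by (intro finite_measure_mono mball_subset_prefix_ball
              determined_sets_M[OF determined_prefix_ball])
        finally show "?m \<le> prob A" .
      qed
      show "\<forall>x\<in>full_shift. \<forall>t\<ge>1. (\<forall>A\<in>?A. \<exists>k<t. (shift ^^ k) x \<in> A) \<longrightarrow>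
          ennreal_of_enat (covering_time \<theta> \<alpha> \<delta> x) \<le> of_nat t"
      proof (intro ballI allI impI)
        fix x t assume t: "1 \<le> t" and hit: "\<forall>A\<in>?A. \<exists>k<t. (shift ^^ k) x \<in> A"
        show "ennreal_of_enat (covering_time \<theta> \<alpha> \<delta> x) \<le> of_nat t"
        proof (rule covering_time_le[OF delta_dense_if_hits_prefix_balls[OF tail wJ s(2)] t])
          fix y assume "y \<in> centers J n"
          then obtain k where "k < t" "(shift ^^ k) x \<in> prefix_ball n s y" using hit by blast
          then show "\<exists>a\<in>(\<lambda>i. (shift ^^ i) x) ` {0..t}. a \<in> prefix_ball n s y" by auto
        qed
      qed
    qed
    also have "\<dots> \<le> ennreal (C / ?m * (real n * ln (real J) + 1))"
    proof (intro ennreal_leI mult_left_mono)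
      have "0 < card ?A" using fin by (simp add: card_gt_0_iff)
      moreover have "card ?A \<le> J ^ n" using card_image_le[OF fin(1)] fin(2) by (rule order_trans)
      ultimately have "ln (real (card ?A)) \<le> ln (real (J ^ n))"
        by (intro ln_mono) (simp_all only: of_nat_le_iff of_nat_0_less_iff)
      also have "\<dots> = real n * ln (real J)" using J by (simp add: ln_realpow)
      finally show "ln (real (card ?A)) + 1 \<le> real n * ln (real J) + 1" by simp
    qed (use C m in simp)
    finally show "expected_covering_time \<theta> \<alpha> M \<delta> \<le> ennreal (C / ?m * (real n * ln (real J) + 1))" .
  qed
qed

end

theorem theorem3p7:
  fixes \<theta> \<alpha> \<kappa> :: real
    and \<phi> :: "(nat \<Rightarrow> nat) \<Rightarrow> real"
    and \<mu> :: "(nat \<Rightarrow> nat) measure"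
  assumes "0 < \<theta>" "\<theta> < 1" "0 < \<alpha>" "1 < \<kappa>"
    and "\<And>n x. 1 \<le> n \<Longrightarrow> x \<in> cylinder [n] \<Longrightarrow> \<phi> x \<le> - \<kappa> * ln (real n + 1)"
    and "gibbs_measure \<phi> \<mu>"
  shows "\<forall>\<delta>\<^sub>0. 0 < \<delta>\<^sub>0 \<and> \<delta>\<^sub>0 < exp (- 1) \<longrightarrow>
    (\<exists>c C \<epsilon>. 0 < c \<and> c < C \<and> 0 < \<epsilon> \<and>
      (\<forall>\<delta>>0. ennreal (c / min_ball_measure \<theta> \<alpha> \<mu> (\<delta> / \<epsilon>))
                \<le> expected_covering_time \<theta> \<alpha> \<mu> \<delta>) \<and>
      (\<forall>\<delta>. 0 < \<delta> \<and> \<delta> \<le> \<delta>\<^sub>0 \<longrightarrow>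
         expected_covering_time \<theta> \<alpha> \<mu> \<delta>
           \<le> ennreal (C / min_ball_measure \<theta> \<alpha> \<mu> (\<epsilon> * \<delta>) * ln (1 / \<delta>) * ln (ln (1 / \<delta>)))))"
proof (intro allI impI)
  fix \<delta>\<^sub>0 :: real
  assume \<delta>0: "0 < \<delta>\<^sub>0 \<and> \<delta>\<^sub>0 < exp (- 1)"
  obtain Q where "quasi_bernoulli_shift \<mu> Q"
    using gibbs_measure_imp_quasi_bernoulli[OF assms(6)] .
  then interpret weighted_quasi_bernoulli_shift \<mu> Q \<theta> \<alpha>
    using assms by (intro weighted_quasi_bernoulli_shift.intro weighted_shift.intro)
  let ?E = "expected_covering_time \<theta> \<alpha> \<mu>" and ?m = "min_ball_measure \<theta> \<alpha> \<mu>"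
  obtain C1 where C1: "0 < C1" and time:
    "\<And>\<delta> s n J. 0 < s \<Longrightarrow> s \<le> \<delta> / 4 \<Longrightarrow> 1 \<le> J \<Longrightarrow> \<theta> ^ n / (1 - \<theta>) \<le> \<delta> / 2 \<Longrightarrow>
       w J / (1 - \<theta>) \<le> \<delta> / 4 \<Longrightarrow> (\<And>i. i < n \<Longrightarrow> 2 * s \<le> \<theta> ^ i * (w 1 - w 2)) \<Longrightarrow>
       ?E \<delta> \<le> ennreal (C1 / ?m s * (real n * ln (real J) + 1))"
    using expected_covering_time_le by blast
  obtain C2 where C2: "0 < C2" and param: "\<And>\<delta>. 0 < \<delta> \<Longrightarrow> \<delta> \<le> \<delta>\<^sub>0 \<Longrightarrow>
    \<exists>n J. 1 \<le> J \<and> \<theta> ^ n / (1 - \<theta>) \<le> \<delta> / 2 \<and>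
    w J / (1 - \<theta>) \<le> \<delta> / 4 \<and> (\<forall>i<n. \<delta> * (1 - \<theta>) / 2 \<le> \<theta> ^ i) \<and>
    real n * ln (real J) + 1 \<le> C2 * ln (1 / \<delta>) * ln (ln (1 / \<delta>))"
    using ex_cover_parameters[of \<delta>\<^sub>0] \<delta>0 by metis
  \<comment> \<open>The largest factor for which twice the radius \<open>\<epsilon> * \<delta>\<close> is at most \<open>\<theta> ^ i * (w 1 - w 2)\<close> whenever \<open>\<theta> ^ i \<ge> \<delta> * (1 - \<theta>) / 2\<close>.\<close>
  define \<epsilon> where "\<epsilon> = (1 - \<theta>) * (w 1 - w 2) / 4"
  have gap: "0 < w 1 - w 2" "w 1 - w 2 \<le> 1"
    using w_strict_antimono[of 1 2] w_diff_le[of 1 2] by auto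
  have eps: "0 < \<epsilon>" "\<epsilon> \<le> 1 / 4"
  proof -
    show "0 < \<epsilon>" using gap theta by (simp add: \<epsilon>_def)
    have "(1 - \<theta>) * (w 1 - w 2) \<le> 1 * 1" using gap theta by (intro mult_mono) auto
    then show "\<epsilon> \<le> 1 / 4" by (simp add: \<epsilon>_def)
  qed
  \<comment> \<open>The summand \<open>1\<close> only serves to make \<open>C\<close> exceed the constant \<open>1 / 16\<close> of the lower bound.\<close>
  define C where "C = C1 * C2 + 1"
  have C: "1 / 16 < C" "C1 * C2 \<le> C" unfolding C_def using mult_pos_pos[OF C1 C2] by auto
  have lower: "ennreal (1 / 16 / ?m (\<delta> / \<epsilon>)) \<le> ?E \<delta>" if "0 < \<delta>" for \<delta>
  proof (rule expected_covering_time_ge_min_ball[OF that])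
    have "\<delta> * \<epsilon> < \<delta> * 1" using that eps by (intro mult_strict_left_mono) auto
    then show "\<delta> < \<delta> / \<epsilon>" using eps by (simp add: pos_less_divide_eq)
  qed
  have upper: "?E \<delta> \<le> ennreal (C / ?m (\<epsilon> * \<delta>) * ln (1 / \<delta>) * ln (ln (1 / \<delta>)))"
    if \<delta>: "0 < \<delta>" "\<delta> \<le> \<delta>\<^sub>0" for \<delta>
  proof -
    obtain n J where nJ: "1 \<le> J" "\<theta> ^ n / (1 - \<theta>) \<le> \<delta> / 2" "w J / (1 - \<theta>) \<le> \<delta> / 4"
      and i: "\<And>i. i < n \<Longrightarrow> \<delta> * (1 - \<theta>) / 2 \<le> \<theta> ^ i"
      and size: "real n * ln (real J) + 1 \<le> C2 * ln (1 / \<delta>) * ln (ln (1 / \<delta>))"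
      using param[OF \<delta>] by blast
    have s: "0 < \<epsilon> * \<delta>" using eps \<delta> by simp
    have m: "0 < ?m (\<epsilon> * \<delta>)" by (rule min_ball_measure_pos[OF s])
    have "?E \<delta> \<le> ennreal (C1 / ?m (\<epsilon> * \<delta>) * (real n * ln (real J) + 1))"
    proof (rule time[OF s _ nJ])
      show "\<epsilon> * \<delta> \<le> \<delta> / 4" using mult_right_mono[OF eps(2), of \<delta>] \<delta> by simp
      fix k assume "k < n"
      have "2 * (\<epsilon> * \<delta>) = \<delta> * (1 - \<theta>) / 2 * (w 1 - w 2)" by (simp add: \<epsilon>_def)
      also have "\<dots> \<le> \<theta> ^ k * (w 1 - w 2)"
        using i[OF \<open>k < n\<close>] gap by (intro mult_right_mono) auto
      finally show "2 * (\<epsilon> * \<delta>) \<le> \<theta> ^ k * (w 1 - w 2)" .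
    qed
    also have "\<dots> \<le> ennreal (C / ?m (\<epsilon> * \<delta>) * ln (1 / \<delta>) * ln (ln (1 / \<delta>)))"
    proof (rule ennreal_leI)
      let ?l = "ln (1 / \<delta>) * ln (ln (1 / \<delta>))"
      have "0 \<le> real n * ln (real J)" using nJ(1) by simp
      then have "0 < C2 * ?l" using size by (simp add: mult.assoc)
      then have l: "0 \<le> ?l" by (rule less_imp_le[OF zero_less_mult_pos[OF _ C2]])
      have "C1 / ?m (\<epsilon> * \<delta>) * (real n * ln (real J) + 1) \<le> C1 / ?m (\<epsilon> * \<delta>) * (C2 * ?l)"
        using size C1 m by (intro mult_left_mono) (auto simp: mult.assoc)
      also have "\<dots> = C1 * C2 * (?l / ?m (\<epsilon> * \<delta>))" by simp
      also have "\<dots> \<le> C * (?l / ?m (\<epsilon> * \<delta>))"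
        using C l m by (intro mult_right_mono) auto
      finally show "C1 / ?m (\<epsilon> * \<delta>) * (real n * ln (real J) + 1)
          \<le> C / ?m (\<epsilon> * \<delta>) * ln (1 / \<delta>) * ln (ln (1 / \<delta>))"
        by (simp add: mult.assoc)
    qed
    finally show ?thesis .
  qed
  show "\<exists>c C \<epsilon>. 0 < c \<and> c < C \<and> 0 < \<epsilon> \<and>
      (\<forall>\<delta>>0. ennreal (c / ?m (\<delta> / \<epsilon>)) \<le> ?E \<delta>) \<and>
      (\<forall>\<delta>. 0 < \<delta> \<and> \<delta> \<le> \<delta>\<^sub>0 \<longrightarrow>
         ?E \<delta> \<le> ennreal (C / ?m (\<epsilon> * \<delta>) * ln (1 / \<delta>) * ln (ln (1 / \<delta>))))"
    by (rule exI[of _ "1 / 16"], rule exI[of _ C], rule exI[of _ \<epsilon>])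
       (use C eps lower upper in simp)
qed

end
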